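(* Let $(\mathcal B,\Psi,\mathcal L,M_z)$ be as in the context (in particular satisfying (A1)–(A3)), and let $\mathcal U$, $\mathcal B'$, $\Psi'$ and the operators $\mathcal L$, $M_z$ on $\mathcal B'$ be the dual objects constructed in the context. Then the dual tuple $(\mathcal B',\Psi',\mathcal L,M_z)$ satisfies the analogues of (A1)–(A3), that is: (A1$'$) $\mathcal B'\hookrightarrow \mathrm{Hol}(\Omega',E)$, the inclusion map being injective and continuous; (A2$'$) the linear span of $\{\Psi'(\bar z)e : e\in E,\ z\in\Omega\}$ is dense in $\mathcal B'$; (A3$'$) $\mathcal L\,\Psi'(\bar z)=\bar z\,\Psi'(\bar z)$ for every $z\in\Omega$. Moreover: (i) the following intertwining relations hold: $$\mathcal L\,\mathcal U=\mathcal U M_z^*\quad\text{and}\quad M_z\,\mathcal U=\mathcal U\mathcal L^*,$$ where on the right-hand sides $M_z^*,\mathcal L^*:\mathcal B^*\to\mathcal B^*$ are the adjoints of $M_z,\mathcal L$ acting on $\mathcal B$, and on the left-hand sides $\mathcal L$ and $M_z$ act on $\mathcal B'$; (ii) for every $e_1,e_2\in E$, $z\in\Omega$, $\lambda\in\Omega'$, $$\langle(\Psi'(\bar z)e_1)(\lambda),e_2\rangle=\langle e_1,(\Psi(\bar\lambda)e_2)(z)\rangle .$$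
   Context: Inner products are linear in the first variable. For $A\subset\mathbb C$ put $A^*=\{\bar z: z\in A\}$. $\mathbf B(E,\mathcal B)$ denotes the bounded linear operators from $E$ to $\mathcal B$. For open $A\subset\mathbb C$, $\mathrm{Hol}(A,E)$ is the space of $E$-valued holomorphic functions on $A$ with the topology of uniform convergence on compact sets. $\mathcal B^*$ is the dual space of bounded linear functionals on $\mathcal B$; for a bounded operator $S$ on $\mathcal B$, $S^*$ on $\mathcal B^*$ is $S^*\varphi=\varphi\circ S$. Setting. $E$ is a complex Hilbert space and $\Omega,\Omega'\subset\mathbb C$ are open sets. $\mathcal B$ is a reflexive Banach space of $E$-valued analytic functions on $\Omega$ on which the multiplication operator $M_z:\mathcal B\to\mathcal B$, $(M_zf)(z)=zf(z)$, acts and is left-invertible; $\mathcal L:\mathcal B\to\mathcal B$ is a (bounded) left inverse of $M_z$; $\Psi:(\Omega')^*\to\mathbf B(E,\mathcal B)$ is an operator-valued holomorphic function. It is assumed that: (A1) $\mathcal B\hookrightarrow\mathrm{Hol}(\Omega,E)$, the inclusion map being injective and continuous; (A2) the linear span of $\{\Psi(\bar\lambda)e: e\in E,\ \lambda\in\Omega'\}$ is dense in $\mathcal B$; (A3) $\mathcal L\Psi(\bar\lambda)=\bar\lambda\Psi(\bar\lambda)$ for every $\lambda\in\Omega'$. Dual objects. $\mathcal U:\mathcal B^*\to\mathrm{Hol}(\Omega',E)$ is the (injective, conjugate-linear) map determined by $$\varphi(\Psi(\bar\lambda)e)=\langle e,(\mathcal U\varphi)(\lambda)\rangle,\qquad e\in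 E,\ \lambda\in\Omega',\ \varphi\in\mathcal B^*.$$ $\mathcal B'$ is the image of $\mathcal B^*$ under $\mathcal U$ with the norm induced from $\mathcal B^*$, so that $\mathcal U:\mathcal B^*\to\mathcal B'$ is a surjective isometry. On $\mathcal B'$, $\mathcal L:=\mathcal U M_z^*\mathcal U^{-1}$, and $M_z$ is multiplication by the independent variable. For $z\in\Omega$, $e\in E$ let $\varphi_{z,e}\in\mathcal B^*$ be $\varphi_{z,e}(f)=\langle f(z),e\rangle$, and define $\Psi':\Omega^*\to\mathbf B(E,\mathcal B')$ by $\Psi'(z)e=\mathcal U\varphi_{\bar z,e}$ for $z\in\Omega^*$, $e\in E$. *)

theory Defs
  imports "HOL-Analysis.Analysis" "HOL-Library.Function_Algebras"
begin

class scaleC =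
  fixes scaleC :: "complex \<Rightarrow> 'a \<Rightarrow> 'a"  (infixr "*\<^sub>C" 75)

class complex_vector = scaleC + ab_group_add +
  assumes scaleC_add_right: "a *\<^sub>C (x + y) = a *\<^sub>C x + a *\<^sub>C y"
    and scaleC_add_left: "(a + b) *\<^sub>C x = a *\<^sub>C x + b *\<^sub>C x"
    and scaleC_scaleC: "a *\<^sub>C b *\<^sub>C x = (a * b) *\<^sub>C x"
    and scaleC_one: "1 *\<^sub>C x = x"

interpretation complex_vector: vector_space "scaleC :: complex \<Rightarrow> 'a \<Rightarrow> 'a::complex_vector"
  by unfold_locales
    (simp_all add: scaleC_add_right scaleC_add_left scaleC_scaleC scaleC_one)

text \<open>The inner product is linear in the \<^emph>\<open>first\<close> variable.\<close>

class complex_hilbert_space = banach + complex_vector +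
  fixes cinner :: "'a \<Rightarrow> 'a \<Rightarrow> complex"
  assumes scaleC_of_real: "complex_of_real r *\<^sub>C x = r *\<^sub>R x"
    and cinner_add_left: "cinner (x + y) z = cinner x z + cinner y z"
    and cinner_scaleC_left: "cinner (a *\<^sub>C x) y = a * cinner x y"
    and cinner_commute: "cinner x y = cnj (cinner y x)"
    and cinner_self: "cinner x x = complex_of_real ((norm x)\<^sup>2)"

instantiation complex :: complex_hilbert_space
begin
definition scaleC_complex :: "complex \<Rightarrow> complex \<Rightarrow> complex"
  where "scaleC_complex a x = a * x"
definition cinner_complex :: "complex \<Rightarrow> complex \<Rightarrow> complex"
  where "cinner_complex x y = x * cnj y"
instance
  by standard
    (simp_all add: scaleC_complex_def cinner_complex_def algebra_simps scaleR_conv_of_real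
      complex_norm_square[symmetric])
end

instantiation "fun" :: (type, complex_vector) complex_vector
begin
definition scaleC_fun :: "complex \<Rightarrow> ('a \<Rightarrow> 'b) \<Rightarrow> 'a \<Rightarrow> 'b"
  where "scaleC_fun a f = (\<lambda>x. a *\<^sub>C f x)"
instance
  by standard
    (simp_all add: scaleC_fun_def fun_eq_iff scaleC_add_right scaleC_add_left scaleC_scaleC
      scaleC_one)
end

text \<open>
  Spaces of functions, their duals and their spaces of operators all carry the pointwise linear
  structure of a function type, so such a space is given by a set of functions and a norm.
  The values of the norm outside the carrier are irrelevant.
\<close>

record 'v nspace =
  carr :: "'v set"
  nrm :: "'v \<Rightarrow> real"

definition norm_dist :: "'v::complex_vector nspace \<Rightarrow> 'v \<Rightarrow> 'v \<Rightarrow> real" where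
  "norm_dist X x y = (if x \<in> carr X \<and> y \<in> carr X then nrm X (x - y) else 0)"

locale complex_normed_space =
  fixes X :: "'v::complex_vector nspace"
  assumes subspace_carr: "complex_vector.subspace (carr X)"
    and nrm_eq_0: "x \<in> carr X \<Longrightarrow> nrm X x = 0 \<longleftrightarrow> x = 0"
    and nrm_scaleC: "x \<in> carr X \<Longrightarrow> nrm X (a *\<^sub>C x) = cmod a * nrm X x"
    and nrm_triangle: "x \<in> carr X \<Longrightarrow> y \<in> carr X \<Longrightarrow> nrm X (x + y) \<le> nrm X x + nrm X y"
begin

lemma nrm_minus: "x \<in> carr X \<Longrightarrow> nrm X (- x) = nrm X x"
  using nrm_scaleC[of x "-1"] by simp

lemma nrm_nonneg: "x \<in> carr X \<Longrightarrow> 0 \<le> nrm X x"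
proof -
  assume x: "x \<in> carr X"
  then have "- x \<in> carr X"
    using complex_vector.subspace_neg[OF subspace_carr] by blast
  with x have "nrm X (x + (- x)) \<le> nrm X x + nrm X (- x)"
    by (rule nrm_triangle)
  moreover have "nrm X (x + (- x)) = 0"
    using nrm_eq_0[of 0] complex_vector.subspace_0[OF subspace_carr] by simp
  ultimately show ?thesis
    using nrm_minus[OF x] by simp
qed

sublocale Metric_space "carr X" "norm_dist X"
proof
  fix x y z
  note diff = complex_vector.subspace_diff[OF subspace_carr]
  show "0 \<le> norm_dist X x y"
    by (simp add: norm_dist_def nrm_nonneg diff)
  show "norm_dist X x y = norm_dist X y x"
    using nrm_minus[OF diff, of x y] by (auto simp: norm_dist_def)
  assume x: "x \<in> carr X" and y: "y \<in> carr X"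
  then show "norm_dist X x y = 0 \<longleftrightarrow> x = y"
    using nrm_eq_0[OF diff, of x y] by (simp add: norm_dist_def)
  assume z: "z \<in> carr X"
  show "norm_dist X x z \<le> norm_dist X x y + norm_dist X y z"
    using nrm_triangle[OF diff[OF x y] diff[OF y z]] x y z by (simp add: norm_dist_def)
qed

end

locale complex_banach_space = complex_normed_space +
  assumes complete: "mcomplete"

definition norm_topology :: "'v::complex_vector nspace \<Rightarrow> 'v topology" where
  "norm_topology X = Metric_space.mtopology (carr X) (norm_dist X)"

definition dense_in :: "'v::complex_vector set \<Rightarrow> 'v nspace \<Rightarrow> bool" where
  "dense_in S X \<longleftrightarrow> S \<subseteq> carr X \<and> norm_topology X closure_of S = carr X"

definition whole_space :: "'v::{complex_vector, real_normed_vector} nspace" where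
  "whole_space = \<lparr>carr = UNIV, nrm = norm\<rparr>"

text \<open>
  Operators are set to \<open>0\<close> off the carrier of their domain, so that equality of operators is
  equality of functions.
\<close>

definition bounded_ops ::
  "'v::complex_vector nspace \<Rightarrow> 'w::complex_vector nspace \<Rightarrow> ('v \<Rightarrow> 'w) nspace" where
  "bounded_ops X Y =
    \<lparr>carr = {T. (\<forall>x. x \<notin> carr X \<longrightarrow> T x = 0) \<and>
                (\<forall>x\<in>carr X. T x \<in> carr Y) \<and>
                (\<forall>x\<in>carr X. \<forall>y\<in>carr X. T (x + y) = T x + T y) \<and>
                (\<forall>a. \<forall>x\<in>carr X. T (a *\<^sub>C x) = a *\<^sub>C T x) \<and>
                (\<exists>C. \<forall>x\<in>carr X. nrm Y (T x) \<le> C * nrm X x)},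
     nrm = (\<lambda>T. Sup {nrm Y (T x) | x. x \<in> carr X \<and> nrm X x \<le> 1})\<rparr>"

definition dual_space :: "'v::complex_vector nspace \<Rightarrow> ('v \<Rightarrow> complex) nspace" where
  "dual_space X = bounded_ops X whole_space"

definition adjoint_op :: "('v \<Rightarrow> 'v) \<Rightarrow> ('v \<Rightarrow> complex) \<Rightarrow> ('v \<Rightarrow> complex)" where
  "adjoint_op S \<phi> = \<phi> \<circ> S"

definition reflexive_space :: "'v::complex_vector nspace \<Rightarrow> bool" where
  "reflexive_space X \<longleftrightarrow>
    (\<lambda>x \<phi>. if \<phi> \<in> carr (dual_space X) then \<phi> x else 0) ` carr X
      = carr (dual_space (dual_space X))"

definition holomorphic_into ::
  "complex set \<Rightarrow> 'v::complex_vector nspace \<Rightarrow> (complex \<Rightarrow> 'v) \<Rightarrow> bool" where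
  "holomorphic_into A X f \<longleftrightarrow>
    (\<forall>z\<in>A. f z \<in> carr X) \<and>
    (\<forall>z\<in>A. \<exists>D\<in>carr X.
      ((\<lambda>w. nrm X (inverse (w - z) *\<^sub>C (f w - f z) - D)) \<longlongrightarrow> 0) (at z within A))"

text \<open>A function on \<open>A\<close> is represented by its extension by \<open>0\<close> to the whole plane.\<close>

definition Hol :: "complex set \<Rightarrow> (complex \<Rightarrow> 'e::complex_hilbert_space) set" where
  "Hol A = {f. holomorphic_into A whole_space f \<and> (\<forall>z. z \<notin> A \<longrightarrow> f z = 0)}"

definition Hol_topology :: "complex set \<Rightarrow> (complex \<Rightarrow> 'e::complex_hilbert_space) topology" where
  "Hol_topology A = topology (\<lambda>W. W \<subseteq> Hol A \<and>
    (\<forall>f\<in>W. \<exists>K \<epsilon>. compact K \<and> K \<subseteq> A \<and> 0 < \<epsilon> \<and>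
      {g \<in> Hol A. \<forall>z\<in>K. norm (g z - f z) < \<epsilon>} \<subseteq> W))"

lemma openin_Hol_topology:
  fixes W :: "(complex \<Rightarrow> 'e::complex_hilbert_space) set"
  shows "openin (Hol_topology A) W \<longleftrightarrow> W \<subseteq> Hol A \<and>
    (\<forall>f\<in>W. \<exists>K \<epsilon>. compact K \<and> K \<subseteq> A \<and> 0 < \<epsilon> \<and>
      {g \<in> Hol A. \<forall>z\<in>K. norm (g z - f z) < \<epsilon>} \<subseteq> W)"
proof -
  define nbhd where "nbhd f V \<longleftrightarrow> (\<exists>K \<epsilon>. compact K \<and> K \<subseteq> A \<and> 0 < \<epsilon> \<and>
      {g \<in> Hol A. \<forall>z\<in>K. norm (g z - f z) < \<epsilon>} \<subseteq> V)"
    for f and V :: "(complex \<Rightarrow> 'e) set"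
  have int: "nbhd f (S \<inter> T)" if S: "nbhd f S" and T: "nbhd f T" for f S T
  proof -
    obtain K \<epsilon> where K: "compact K" "K \<subseteq> A" "0 < \<epsilon>"
      "{g \<in> Hol A. \<forall>z\<in>K. norm (g z - f z) < \<epsilon>} \<subseteq> S"
      using S unfolding nbhd_def by blast
    obtain J \<delta> where J: "compact J" "J \<subseteq> A" "0 < \<delta>"
      "{g \<in> Hol A. \<forall>z\<in>J. norm (g z - f z) < \<delta>} \<subseteq> T"
      using T unfolding nbhd_def by blast
    have "{g \<in> Hol A. \<forall>z\<in>K \<union> J. norm (g z - f z) < min \<epsilon> \<delta>} \<subseteq> S \<inter> T"
      using K(4) J(4) by auto
    then show ?thesis
      unfolding nbhd_def using K J
      by (intro exI[of _ "K \<union> J"] exI[of _ "min \<epsilon> \<delta>"]) (simp add: compact_Un)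
  qed
  have mono: "nbhd f T" if "nbhd f S" "S \<subseteq> T" for f S T
    using that unfolding nbhd_def by (meson order_trans)
  have "istopology (\<lambda>V. V \<subseteq> Hol A \<and> (\<forall>f\<in>V. nbhd f V))"
    unfolding istopology_def
  proof (intro conjI allI impI)
    fix S T assume "S \<subseteq> Hol A \<and> (\<forall>f\<in>S. nbhd f S)" "T \<subseteq> Hol A \<and> (\<forall>f\<in>T. nbhd f T)"
    then show "S \<inter> T \<subseteq> Hol A" "\<forall>f\<in>S \<inter> T. nbhd f (S \<inter> T)"
      using int by auto
  next
    fix \<K> assume "\<forall>S\<in>\<K>. S \<subseteq> Hol A \<and> (\<forall>f\<in>S. nbhd f S)"
    then show "\<Union>\<K> \<subseteq> Hol A" "\<forall>f\<in>\<Union>\<K>. nbhd f (\<Union>\<K>)"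
      using mono by (blast, metis UnionE Union_upper)
  qed
  then show ?thesis
    unfolding Hol_topology_def nbhd_def by (simp add: topology_inverse')
qed

definition mult_op ::
  "(complex \<Rightarrow> 'e::complex_hilbert_space) nspace \<Rightarrow>
    (complex \<Rightarrow> 'e) \<Rightarrow> (complex \<Rightarrow> 'e)" where
  "mult_op B f = (if f \<in> carr B then (\<lambda>z. z *\<^sub>C f z) else 0)"

text \<open>
  In \<open>cond_A1\<close> the inclusion into the space of holomorphic functions on \<open>A\<close> is \<open>\<lambda>f. f\<close>, because
  elements of \<open>Hol A\<close> are extended by \<open>0\<close>; it takes values in \<open>Hol A\<close> by \<open>continuous_map\<close>.
  Injectivity says that an element is determined by its values on \<open>A\<close>.
\<close>

definition cond_A1 ::
  "(complex \<Rightarrow> 'e::complex_hilbert_space) nspace \<Rightarrow> complex set \<Rightarrow> bool" where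
  "cond_A1 B A \<longleftrightarrow>
    continuous_map (norm_topology B) (Hol_topology A) (\<lambda>f. f) \<and> inj_on (\<lambda>f. restrict f A) (carr B)"

definition cond_A2 ::
  "(complex \<Rightarrow> 'e::complex_hilbert_space) nspace \<Rightarrow> complex set \<Rightarrow>
    (complex \<Rightarrow> 'e \<Rightarrow> (complex \<Rightarrow> 'e)) \<Rightarrow> bool" where
  "cond_A2 B A \<Psi> \<longleftrightarrow> dense_in (complex_vector.span {\<Psi> (cnj l) e | e l. l \<in> A}) B"

definition cond_A3 ::
  "((complex \<Rightarrow> 'e::complex_hilbert_space) \<Rightarrow> (complex \<Rightarrow> 'e)) \<Rightarrow> complex set \<Rightarrow>
    (complex \<Rightarrow> 'e \<Rightarrow> (complex \<Rightarrow> 'e)) \<Rightarrow> bool" where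
  "cond_A3 L A \<Psi> \<longleftrightarrow> (\<forall>l\<in>A. L \<circ> \<Psi> (cnj l) = cnj l *\<^sub>C \<Psi> (cnj l))"

text \<open>
  \<open>dual_map \<Omega>' \<Psi>\<close> is the map \<open>\<U>\<close>; the vector \<open>v\<close> exists for bounded \<open>\<phi>\<close> by the Riesz
  representation theorem. \<open>dual_model\<close> is its image \<open>B'\<close> with the norm carried over from the dual
  of \<open>B\<close>, and \<open>dual_L\<close> is \<open>\<U> M\<^sub>z\<^sup>* \<U>\<^sup>-\<^sup>1\<close> on \<open>B'\<close>.
\<close>

definition dual_map ::
  "complex set \<Rightarrow> (complex \<Rightarrow> 'e \<Rightarrow> (complex \<Rightarrow> 'e)) \<Rightarrow>
    ((complex \<Rightarrow> 'e::complex_hilbert_space) \<Rightarrow> complex) \<Rightarrow> (complex \<Rightarrow> 'e)" where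
  "dual_map \<Omega>' \<Psi> \<phi> =
    (\<lambda>l. if l \<in> \<Omega>' then (THE v. \<forall>e. \<phi> (\<Psi> (cnj l) e) = cinner e v) else 0)"

definition dual_model ::
  "(complex \<Rightarrow> 'e::complex_hilbert_space) nspace \<Rightarrow> complex set \<Rightarrow>
    (complex \<Rightarrow> 'e \<Rightarrow> (complex \<Rightarrow> 'e)) \<Rightarrow> (complex \<Rightarrow> 'e) nspace" where
  "dual_model B \<Omega>' \<Psi> =
    \<lparr>carr = dual_map \<Omega>' \<Psi> ` carr (dual_space B),
     nrm = (\<lambda>g. nrm (dual_space B) (inv_into (carr (dual_space B)) (dual_map \<Omega>' \<Psi>) g))\<rparr>"

definition dual_L ::
  "(complex \<Rightarrow> 'e::complex_hilbert_space) nspace \<Rightarrow> complex set \<Rightarrow>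
    (complex \<Rightarrow> 'e \<Rightarrow> (complex \<Rightarrow> 'e)) \<Rightarrow> (complex \<Rightarrow> 'e) \<Rightarrow> (complex \<Rightarrow> 'e)" where
  "dual_L B \<Omega>' \<Psi> g =
    (if g \<in> carr (dual_model B \<Omega>' \<Psi>)
     then dual_map \<Omega>' \<Psi> (adjoint_op (mult_op B)
            (inv_into (carr (dual_space B)) (dual_map \<Omega>' \<Psi>) g))
     else 0)"

definition eval_functional ::
  "(complex \<Rightarrow> 'e::complex_hilbert_space) nspace \<Rightarrow> complex \<Rightarrow> 'e \<Rightarrow>
    (complex \<Rightarrow> 'e) \<Rightarrow> complex" where
  "eval_functional B z e = (\<lambda>f. if f \<in> carr B then cinner (f z) e else 0)"

definition dual_Psi ::
  "(complex \<Rightarrow> 'e::complex_hilbert_space) nspace \<Rightarrow> complex set \<Rightarrow>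
    (complex \<Rightarrow> 'e \<Rightarrow> (complex \<Rightarrow> 'e)) \<Rightarrow> complex \<Rightarrow> 'e \<Rightarrow> (complex \<Rightarrow> 'e)" where
  "dual_Psi B \<Omega>' \<Psi> z e = dual_map \<Omega>' \<Psi> (eval_functional B (cnj z) e)"

end

theory Submission
  imports Defs
begin

text \<open>
  Everything is read off from the vectors \<open>\<U> \<phi> l\<close>, which represent the functionals
  \<open>\<phi> \<circ> \<Psi> (cnj l)\<close> on \<open>'e\<close>. By the Riesz representation theorem they exist, and
  \<open>norm (\<U> \<phi> l)\<close> is at most the norm of \<open>\<phi>\<close> times the operator norm of \<open>\<Psi> (cnj l)\<close>. The same estimate,
  applied to difference quotients of \<open>\<Psi>\<close>, shows that \<open>\<U> \<phi>\<close> is holomorphic; applied on a compact set, where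
  the operator norm of \<open>\<Psi>\<close> is bounded, it shows that the inclusion of \<open>B'\<close> is continuous. Density
  of the span of the vectors \<open>\<Psi> (cnj l) e\<close> makes \<open>\<U>\<close> injective, so that the norm and the
  operators can be carried over from the dual of \<open>B\<close>.

  The eigenvector relation of the dual model and the two intertwining relations come from moving
  a scalar through the inner product. The evaluation functional at \<open>z\<close> is an eigenvector of the
  adjoint of the multiplication operator, with eigenvalue \<open>z\<close>; the eigenvalue is conjugated
  because \<open>\<U>\<close> is conjugate-linear. Likewise \<open>L\<close> acts on \<open>\<Psi> (cnj l) e\<close> as the scalar
  \<open>cnj l\<close>, which becomes multiplication by \<open>l\<close> in the second argument of the inner product. The symmetry
  between \<open>\<Psi>\<close> and \<open>\<Psi>'\<close> is the defining relation of \<open>\<U>\<close> at an evaluation functional.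

  Density of the evaluation functionals in the dual of \<open>B\<close> is where reflexivity enters. If their
  span were not dense, the Hahn-Banach theorem would give a nonzero functional on the dual that
  vanishes on all of them. By reflexivity this functional is evaluation at some \<open>f\<close> in \<open>B\<close>; then
  \<open>f z = 0\<close> for every \<open>z\<close> in \<open>\<Omega>\<close>, hence \<open>f = 0\<close>, a contradiction. The Hahn-Banach theorem is obtained
  from the fact that a minimal sublinear functional is linear.
\<close>

section \<open>The Riesz representation theorem\<close>

lemma cinner_zero_left [simp]: "cinner 0 y = 0"
  using cinner_add_left[of 0 0 y] by simp

lemma cinner_minus_left: "cinner (- x) y = - cinner x y"
  using cinner_add_left[of x "- x" y] by (simp add: eq_neg_iff_add_eq_0 add.commute)

lemma cinner_add_right: "cinner x (y + z) = cinner x y + cinner x z"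
  using cinner_add_left[of y z x] cinner_commute by (metis complex_cnj_add)

lemma cinner_scaleC_right: "cinner x (a *\<^sub>C y) = cnj a * cinner x y"
  using cinner_scaleC_left[of a y x] cinner_commute by (metis complex_cnj_mult)

lemma cinner_eqI:
  assumes "\<And>e. cinner e u = cinner e v"
  shows "u = v"
proof -
  have "cinner (u - v) (u - v) = cinner (u - v) u + cinner (u - v) (- v)"
    using cinner_add_right[of "u - v" u "- v"] by simp
  also have "cinner (u - v) (- v) = - cinner (u - v) v"
    using cinner_add_right[of "u - v" v "- v"] cinner_commute[of "u - v" 0]
    by (simp add: eq_neg_iff_add_eq_0 add.commute)
  finally have "cinner (u - v) (u - v) = 0"
    using assms by simp
  then show ?thesis
    by (simp add: cinner_self)
qed

lemma norm_scaleC: "norm (a *\<^sub>C x) = cmod a * norm (x :: 'e::complex_hilbert_space)"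
proof -
  have "complex_of_real ((norm (a *\<^sub>C x))\<^sup>2) = a * cnj a * cinner x x"
    unfolding cinner_self[symmetric] by (simp add: cinner_scaleC_left cinner_scaleC_right)
  also have "\<dots> = complex_of_real ((cmod a * norm x)\<^sup>2)"
    by (simp add: cinner_self power_mult_distrib flip: complex_norm_square)
  finally have "complex_of_real ((norm (a *\<^sub>C x))\<^sup>2) = complex_of_real ((cmod a * norm x)\<^sup>2)" .
  then have "(norm (a *\<^sub>C x))\<^sup>2 = (cmod a * norm x)\<^sup>2"
    using of_real_eq_iff by blast
  then show ?thesis
    by (simp add: power2_eq_iff_nonneg)
qed

lemma norm_add_square:
  fixes x y :: "'e::complex_hilbert_space"
  shows "(norm (x + y))\<^sup>2 = (norm x)\<^sup>2 + (norm y)\<^sup>2 + 2 * Re (cinner y x)"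
proof -
  have sq: "(norm u)\<^sup>2 = Re (cinner u u)" for u :: 'e
    by (simp add: cinner_self)
  have "Re (cinner x y) = Re (cinner y x)"
    by (subst cinner_commute) simp
  then show ?thesis
    unfolding sq by (simp add: cinner_add_left cinner_add_right)
qed

lemma cmod_cinner_le: "cmod (cinner x y) \<le> norm x * norm (y :: 'e::complex_hilbert_space)"
proof -
  \<comment> \<open>A phase \<open>a\<close> makes the inner product real and nonnegative.\<close>
  define a where "a = cnj (sgn (cinner x y))"
  have "a * cinner x y = complex_of_real (cmod (cinner x y))"
    by (cases "cinner x y = 0")
      (simp_all add: a_def sgn_div_norm scaleR_conv_of_real power2_eq_square
        complex_norm_square[symmetric] field_simps)
  then have "cmod (cinner x y) = Re (cinner (a *\<^sub>C x) y)"
    by (simp add: cinner_scaleC_left)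
  also have "(norm (y + a *\<^sub>C x))\<^sup>2 \<le> (norm y + norm (a *\<^sub>C x))\<^sup>2"
    by (intro power_mono norm_triangle_ineq) simp
  then have "Re (cinner (a *\<^sub>C x) y) \<le> norm (a *\<^sub>C x) * norm y"
    unfolding norm_add_square by (simp add: power2_sum mult.commute)
  also have "\<dots> \<le> norm x * norm y"
    by (intro mult_right_mono) (simp_all add: a_def norm_scaleC norm_sgn)
  finally show ?thesis .
qed

text \<open>
  For small \<open>t\<close> the linear term dominates; the value \<open>t = - b / (\<bar>a\<bar> + 1)\<close> is small enough.
\<close>

lemma quadratic_nonneg_imp_linear_coeff_zero:
  fixes a b :: real
  assumes "\<And>t. 0 \<le> t\<^sup>2 * a + t * b"
  shows "b = 0"
proof -
  define c s where "c = \<bar>a\<bar> + 1" and "s = - b / c"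
  have "c > 0"
    unfolding c_def by simp
  then have b: "b = - s * c"
    unfolding s_def by simp
  have "s\<^sup>2 * a \<le> s\<^sup>2 * (c - 1)"
    unfolding c_def by (intro mult_left_mono) auto
  then have "s\<^sup>2 \<le> 0"
    using assms[of s] unfolding b by (simp add: power2_eq_square algebra_simps)
  then show ?thesis
    using b by simp
qed

text \<open>
  The representing vector minimises \<open>J x = (norm x)\<^sup>2 - 2 * Re (f x)\<close>, which differs by a
  constant from the squared distance of \<open>x\<close> to that vector. The parallelogram law makes minimising
  sequences Cauchy, and the first variation of \<open>J\<close> at the minimum gives the representation.
\<close>

theorem riesz_representation:
  fixes f :: "'e::complex_hilbert_space \<Rightarrow> complex"
  assumes add: "\<And>x y. f (x + y) = f x + f y"
    and scale: "\<And>a x. f (a *\<^sub>C x) = a * f x"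
    and bound: "\<And>x. cmod (f x) \<le> C * norm x"
  shows "\<exists>v. \<forall>x. f x = cinner x v"
proof -
  have lin: "bounded_linear f"
  proof (rule bounded_linear_intro)
    show "f (r *\<^sub>R x) = r *\<^sub>R f x" for r x
      using scale[of "complex_of_real r" x] by (simp add: scaleC_of_real scaleR_conv_of_real)
    show "norm (f x) \<le> norm x * C" for x
      using bound[of x] by (simp add: mult.commute)
  qed (rule add)
  define J where "J x = (norm x)\<^sup>2 - 2 * Re (f x)" for x
  have expand: "J (x + h) = J x + (norm h)\<^sup>2 + 2 * (Re (cinner h x) - Re (f h))" for x h
    unfolding J_def by (simp add: norm_add_square add)
  have lower: "- C\<^sup>2 \<le> J x" for x
  proof -
    have "Re (f x) \<le> C * norm x"
      using bound[of x] complex_Re_le_cmod[of "f x"] by linarith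
    moreover have "0 \<le> (norm x - C)\<^sup>2"
      by simp
    ultimately show ?thesis
      unfolding J_def power2_diff by (simp add: mult.commute)
  qed
  define m where "m = (INF x. J x)"
  have m_le: "m \<le> J x" for x
    unfolding m_def using lower by (intro cINF_lower bdd_belowI2) auto
  have "\<exists>x. J x < m + inverse (real (Suc n))" for n
  proof -
    have "m < m + inverse (real (Suc n))"
      by simp
    then show ?thesis
      unfolding m_def using lower
      by (subst (asm) (1) cINF_less_iff) (auto intro!: bdd_belowI2)
  qed
  then obtain X where X: "\<And>n. J (X n) < m + inverse (real (Suc n))"
    by metis
  have par: "(norm (x - y))\<^sup>2 \<le> 2 * (J x - m) + 2 * (J y - m)" for x y
  proof -
    \<comment> \<open>The parallelogram law, as two expansions of \<open>J\<close> around the midpoint \<open>c\<close> of \<open>x\<close> and \<open>y\<close>.\<close>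
    define c h where "c = (1/2) *\<^sub>R (x + y)" and "h = (1/2) *\<^sub>R (x - y)"
    have nh: "norm (x - y) = 2 * norm h"
      unfolding h_def by simp
    have xy: "x = c + h" "y = c + - h"
      unfolding c_def h_def by (simp_all add: scaleR_add_right scaleR_diff_right flip: scaleR_add_left)
    have "f (- h) = - f h"
      using lin by (simp add: linear_neg bounded_linear.linear)
    then have "J x + J y = 2 * J c + 2 * (norm h)\<^sup>2"
      unfolding xy expand by (simp add: cinner_minus_left)
    then show ?thesis
      using m_le[of c] unfolding nh by (simp add: power_mult_distrib)
  qed
  have "Cauchy X"
  proof (rule metric_CauchyI)
    fix e :: real assume e: "0 < e"
    then obtain N where N: "inverse (real (Suc N)) < e\<^sup>2 / 4"
      using reals_Archimedean[of "e\<^sup>2 / 4"] by auto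
    have small: "4 * (J (X n) - m) < e\<^sup>2" if "n \<ge> N" for n
    proof -
      have "inverse (real (Suc n)) \<le> inverse (real (Suc N))"
        using that by (intro le_imp_inverse_le) auto
      then have "J (X n) < m + e\<^sup>2 / 4"
        using X[of n] N by (meson add_strict_left_mono le_less_trans less_trans)
      then show ?thesis
        by (simp add: field_simps)
    qed
    have "dist (X i) (X j) < e" if "i \<ge> N" "j \<ge> N" for i j
    proof -
      have "(norm (X i - X j))\<^sup>2 < e\<^sup>2"
        using par[of "X i" "X j"] small[OF that(1)] small[OF that(2)] by (simp add: field_simps)
      then show ?thesis
        unfolding dist_norm using e by (simp add: power2_less_imp_less)
    qed
    then show "\<exists>N. \<forall>i\<ge>N. \<forall>j\<ge>N. dist (X i) (X j) < e"
      by blast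
  qed
  then obtain v where v: "X \<longlonglongrightarrow> v"
    using Cauchy_convergent_iff convergent_def by blast
  have "(\<lambda>n. J (X n)) \<longlonglongrightarrow> J v"
    unfolding J_def by (intro tendsto_intros v bounded_linear.tendsto[OF lin])
  moreover have "(\<lambda>n. m + inverse (real (Suc n))) \<longlonglongrightarrow> m + 0"
    by (intro tendsto_add tendsto_const LIMSEQ_inverse_real_of_nat)
  ultimately have "J v \<le> m + 0"
    using X by (intro LIMSEQ_le) (auto intro: less_imp_le)
  \<comment> \<open>The first variation of \<open>J\<close> at its minimum \<open>v\<close> vanishes in every direction \<open>h\<close>.\<close>
  have re: "Re (cinner h v) = Re (f h)" for h
  proof -
    have "0 \<le> t\<^sup>2 * (norm h)\<^sup>2 + t * (2 * (Re (cinner h v) - Re (f h)))" for t :: real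
    proof -
      have "J v \<le> J (v + complex_of_real t *\<^sub>C h)"
        using \<open>J v \<le> m + 0\<close> m_le[of "v + complex_of_real t *\<^sub>C h"] by simp
      then show ?thesis
        unfolding expand
        by (simp add: norm_scaleC scale cinner_scaleC_left power_mult_distrib algebra_simps)
    qed
    from quadratic_nonneg_imp_linear_coeff_zero[OF this] show ?thesis
      by simp
  qed
  have "f h = cinner h v" for h
    \<comment> \<open>The direction \<open>\<i> *\<^sub>C h\<close> turns the real parts into imaginary parts.\<close>
    using re[of h] re[of "\<i> *\<^sub>C h"] by (simp add: complex_eq_iff scale cinner_scaleC_left)
  then show ?thesis
    by blast
qed

section \<open>Linear functionals below sublinear functionals\<close>

text \<open>
  Homogeneity is stated as an inequality because infima inherit that form directly; the
  reverse inequality follows by scaling back, see \<open>sublinear_on_scale\<close>.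
\<close>

definition sublinear_on :: "'v::complex_vector set \<Rightarrow> ('v \<Rightarrow> real) \<Rightarrow> bool" where
  "sublinear_on V q \<longleftrightarrow>
    (\<forall>x\<in>V. \<forall>y\<in>V. q (x + y) \<le> q x + q y) \<and>
    (\<forall>x\<in>V. \<forall>t\<ge>0. q (complex_of_real t *\<^sub>C x) \<le> t * q x)"

lemma sublinear_on_add: "sublinear_on V q \<Longrightarrow> x \<in> V \<Longrightarrow> y \<in> V \<Longrightarrow> q (x + y) \<le> q x + q y"
  by (simp add: sublinear_on_def)

lemma sublinear_on_scale_le:
  "sublinear_on V q \<Longrightarrow> x \<in> V \<Longrightarrow> 0 \<le> t \<Longrightarrow> q (complex_of_real t *\<^sub>C x) \<le> t * q x"
  by (simp add: sublinear_on_def)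

lemma sublinear_on_zero:
  assumes "complex_vector.subspace V" "sublinear_on V q"
  shows "q 0 = 0"
  using sublinear_on_add[OF assms(2), of 0 0] sublinear_on_scale_le[OF assms(2), of 0 0]
    complex_vector.subspace_0[OF assms(1)] by simp

lemma sublinear_on_scale:
  assumes V: "complex_vector.subspace V" and q: "sublinear_on V q" and x: "x \<in> V" and t: "0 \<le> t"
  shows "q (complex_of_real t *\<^sub>C x) = t * q x"
proof (cases "t = 0")
  case True
  then show ?thesis
    using sublinear_on_zero[OF V q] by simp
next
  case False
  define y where "y = complex_of_real t *\<^sub>C x"
  have y: "y \<in> V"
    unfolding y_def using V x by (rule complex_vector.subspace_scale)
  have "complex_of_real (inverse t) *\<^sub>C y = x"
    unfolding y_def using False by (simp add: scaleC_scaleC scaleC_one flip: of_real_mult)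
  then have "q x \<le> inverse t * q y"
    using sublinear_on_scale_le[OF q y, of "inverse t"] t by simp
  then have "t * q x \<le> q y"
    using t False by (simp add: field_simps)
  then show ?thesis
    using sublinear_on_scale_le[OF q x t] by (simp add: y_def)
qed

lemma sublinear_on_lower:
  assumes V: "complex_vector.subspace V" and q: "sublinear_on V q" and x: "x \<in> V"
  shows "- q (- x) \<le> q x"
  using sublinear_on_add[OF q x complex_vector.subspace_neg[OF V x]] sublinear_on_zero[OF V q]
  by simp

text \<open>
  A pair \<open>(k, s)\<close> encodes the constraint \<open>s \<le> l k\<close> on a linear functional \<open>l \<le> q\<close>. The
  constraints form a convex cone below the graph of \<open>q\<close>, which makes them compatible with each other.
\<close>

definition minorant_cone ::
  "'v::complex_vector set \<Rightarrow> ('v \<Rightarrow> real) \<Rightarrow> ('v \<times> real) set \<Rightarrow> bool" where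
  "minorant_cone V q K \<longleftrightarrow>
    (0, 0) \<in> K \<and>
    (\<forall>k s. (k, s) \<in> K \<longrightarrow> k \<in> V \<and> s \<le> q k) \<and>
    (\<forall>k s k' s'. (k, s) \<in> K \<longrightarrow> (k', s') \<in> K \<longrightarrow> (k + k', s + s') \<in> K) \<and>
    (\<forall>k s t. (k, s) \<in> K \<longrightarrow> 0 \<le> t \<longrightarrow> (complex_of_real t *\<^sub>C k, t * s) \<in> K)"

text \<open>
  Passing to the infimum builds the constraints of the cone into the upper bound: any linear
  functional below \<open>r\<close> satisfies \<open>l (- k) \<le> - s\<close>, that is \<open>s \<le> l k\<close>. The lower bound
  \<open>- q (- x)\<close> for the terms of the infimum is where \<open>s \<le> q k\<close> is used.
\<close>

lemma sublinear_on_cone_inf: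
  fixes K :: "('v::complex_vector \<times> real) set"
  assumes V: "complex_vector.subspace V" and q: "sublinear_on V q"
    and K: "minorant_cone V q K"
  defines "r \<equiv> \<lambda>x. INF ks\<in>K. q (x + fst ks) - snd ks"
  shows "sublinear_on V r"
    and "\<And>x. x \<in> V \<Longrightarrow> r x \<le> q x"
    and "\<And>k s. (k, s) \<in> K \<Longrightarrow> r (- k) \<le> - s"
proof -
  have KV: "k \<in> V \<and> s \<le> q k" if "(k, s) \<in> K" for k s
    using K that unfolding minorant_cone_def by blast
  have K0: "(0, 0) \<in> K"
    using K unfolding minorant_cone_def by blast
  have Kadd: "(k + k', s + s') \<in> K" if "(k, s) \<in> K" "(k', s') \<in> K" for k s k' s'
    using K that unfolding minorant_cone_def by blast
  have Kscale: "(complex_of_real t *\<^sub>C k, t * s) \<in> K" if "(k, s) \<in> K" "0 \<le> t" for k s t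
    using K that unfolding minorant_cone_def by blast
  have lower: "- q (- x) \<le> q (x + k) - s" if "x \<in> V" "(k, s) \<in> K" for x k s
  proof -
    have "q (x + k + - x) \<le> q (x + k) + q (- x)"
      using that KV[OF that(2)] V
      by (intro sublinear_on_add[OF q] complex_vector.subspace_add complex_vector.subspace_neg) auto
    then show ?thesis
      using KV[OF that(2)] by simp
  qed
  have r_le: "r x \<le> q (x + k) - s" if "x \<in> V" "(k, s) \<in> K" for x k s
    unfolding r_def
    using that lower[OF that(1)] by (intro cINF_lower2[where x = "(k, s)"] bdd_belowI2) auto
  have r_ge: "c \<le> r x" if "\<And>k s. (k, s) \<in> K \<Longrightarrow> c \<le> q (x + k) - s" for c x
    unfolding r_def using that K0 by (intro cINF_greatest) auto
  show "r x \<le> q x" if "x \<in> V" for x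
    using r_le[OF that K0] by simp
  show "r (- k) \<le> - s" if "(k, s) \<in> K" for k s
    using r_le[OF complex_vector.subspace_neg[OF V, of k] that] KV[OF that] sublinear_on_zero[OF V q]
    by simp
  show "sublinear_on V r"
    unfolding sublinear_on_def
  proof (intro conjI ballI allI impI)
    fix x y assume x: "x \<in> V" and y: "y \<in> V"
    have "r (x + y) - (q (x + k) - s) \<le> q (y + k') - s'" if k: "(k, s) \<in> K" and k': "(k', s') \<in> K"
      for k s k' s'
    proof -
      have "r (x + y) \<le> q (x + y + (k + k')) - (s + s')"
        by (rule r_le[OF complex_vector.subspace_add[OF V x y] Kadd[OF k k']])
      also have "q (x + y + (k + k')) = q ((x + k) + (y + k'))"
        by (simp add: algebra_simps)
      also have "\<dots> \<le> q (x + k) + q (y + k')"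
        using x y KV[OF k] KV[OF k'] V
        by (intro sublinear_on_add[OF q] complex_vector.subspace_add) auto
      finally show ?thesis
        by linarith
    qed
    then have "r (x + y) - (q (x + k) - s) \<le> r y" if "(k, s) \<in> K" for k s
      using that r_ge by blast
    then have "r (x + y) - r y \<le> q (x + k) - s" if "(k, s) \<in> K" for k s
      using that by (smt (verit))
    then have "r (x + y) - r y \<le> r x"
      using r_ge by blast
    then show "r (x + y) \<le> r x + r y"
      by linarith
  next
    fix x :: 'v and t :: real assume x: "x \<in> V" and t: "0 \<le> t"
    show "r (complex_of_real t *\<^sub>C x) \<le> t * r x"
    proof (cases "t = 0")
      case True
      then show ?thesis
        using r_le[OF complex_vector.subspace_0[OF V] K0] sublinear_on_zero[OF V q] by simp
    next
      case False
      have "r (complex_of_real t *\<^sub>C x) / t \<le> q (x + k) - s" if k: "(k, s) \<in> K" for k s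
      proof -
        have "r (complex_of_real t *\<^sub>C x) \<le> q (complex_of_real t *\<^sub>C (x + k)) - t * s"
          using r_le[OF complex_vector.subspace_scale[OF V x] Kscale[OF k t]]
          by (simp add: scaleC_add_right)
        also have "\<dots> \<le> t * (q (x + k) - s)"
          using sublinear_on_scale_le[OF q complex_vector.subspace_add[OF V x], of k t] KV[OF k] t
          by (simp add: algebra_simps)
        finally show ?thesis
          using t False by (simp add: field_simps)
      qed
      then have "r (complex_of_real t *\<^sub>C x) / t \<le> r x"
        by (rule r_ge)
      then show ?thesis
        using t False by (simp add: field_simps)
    qed
  qed
qed

lemma sublinear_on_cong:
  assumes "complex_vector.subspace V" "\<And>x. x \<in> V \<Longrightarrow> q x = q' x"
  shows "sublinear_on V q = sublinear_on V q'"
  using assms complex_vector.subspace_add[OF assms(1)] complex_vector.subspace_scale[OF assms(1)]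
  unfolding sublinear_on_def by simp

lemma sublinear_on_chain_inf:
  assumes V: "complex_vector.subspace V" and p: "sublinear_on V p" and "C \<noteq> {}"
    and C: "\<forall>c\<in>C. sublinear_on V c \<and> (\<forall>x\<in>V. c x \<le> p x)"
    and chain: "\<forall>c\<in>C. \<forall>d\<in>C. (\<forall>x\<in>V. c x \<le> d x) \<or> (\<forall>x\<in>V. d x \<le> c x)"
  defines "r \<equiv> \<lambda>x. INF c\<in>C. c x"
  shows "sublinear_on V r" and "\<And>c x. c \<in> C \<Longrightarrow> x \<in> V \<Longrightarrow> r x \<le> c x"
proof -
  have "- p (- x) \<le> c x" if "x \<in> V" "c \<in> C" for x c
    using sublinear_on_lower[OF V, of c x] C that
      complex_vector.subspace_neg[OF V that(1)] by force
  then show r_le: "r x \<le> c x" if "c \<in> C" "x \<in> V" for c x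
    unfolding r_def using that by (intro cINF_lower bdd_belowI2) auto
  have r_ge: "b \<le> r x" if "\<And>c. c \<in> C \<Longrightarrow> b \<le> c x" for b x
    unfolding r_def using that \<open>C \<noteq> {}\<close> by (intro cINF_greatest) auto
  show "sublinear_on V r"
    unfolding sublinear_on_def
  proof (intro conjI ballI allI impI)
    fix x y assume x: "x \<in> V" and y: "y \<in> V"
    have "r (x + y) \<le> c x + d y" if c: "c \<in> C" and d: "d \<in> C" for c d
    proof -
      have "r (x + y) \<le> c x + c y" "r (x + y) \<le> d x + d y"
        using r_le[of _ "x + y"] sublinear_on_add[of V _ x y] C c d x y
          complex_vector.subspace_add[OF V x y] by (meson order_trans)+
      then show ?thesis
        using chain c d x y by force
    qed
    then have "r (x + y) - c x \<le> d y" if "c \<in> C" "d \<in> C" for c d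
      using that by (simp add: diff_le_eq add.commute)
    then have "r (x + y) - c x \<le> r y" if "c \<in> C" for c
      using that r_ge by blast
    then have "r (x + y) - r y \<le> c x" if "c \<in> C" for c
      using that by (simp add: algebra_simps)
    then have "r (x + y) - r y \<le> r x"
      using r_ge by blast
    then show "r (x + y) \<le> r x + r y"
      by linarith
  next
    fix x :: 'a and t :: real assume x: "x \<in> V" and t: "0 \<le> t"
    have le: "r (complex_of_real t *\<^sub>C x) \<le> t * c x" if c: "c \<in> C" for c
      using r_le[OF c complex_vector.subspace_scale[OF V x]]
        sublinear_on_scale_le[of V c x t] C c x t by (meson order_trans)
    show "r (complex_of_real t *\<^sub>C x) \<le> t * r x"
    proof (cases "t = 0")
      case True
      then show ?thesis
        using le \<open>C \<noteq> {}\<close> by auto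
    next
      case False
      have "r (complex_of_real t *\<^sub>C x) / t \<le> r x"
        using le t False by (intro r_ge) (simp add: field_simps)
      then show ?thesis
        using t False by (simp add: field_simps)
    qed
  qed
qed

text \<open>
  The analytic Hahn-Banach theorem without any extension step. Zorn's lemma gives a minimal
  sublinear \<open>q \<le> p\<close>. For each \<open>y\<close>, the ray through \<open>(y, q y)\<close> is a cone of constraints, so
  \<open>sublinear_on_cone_inf\<close> produces a smaller sublinear functional, which must be \<open>q\<close> itself;
  hence \<open>q (- y) \<le> - q y\<close>, and this makes \<open>q\<close> additive.
\<close>

lemma linear_below_sublinear:
  assumes V: "complex_vector.subspace V" and p: "sublinear_on V p"
  obtains q where "\<And>x. x \<in> V \<Longrightarrow> q x \<le> p x"
    and "\<And>x y. x \<in> V \<Longrightarrow> y \<in> V \<Longrightarrow> q (x + y) = q x + q y"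
    and "\<And>x t. x \<in> V \<Longrightarrow> q (complex_of_real t *\<^sub>C x) = t * q x"
proof -
  \<comment> \<open>Prescribing the values off \<open>V\<close> makes the pointwise order on \<open>V\<close> antisymmetric on \<open>A\<close>.\<close>
  define A where
    "A = {q. sublinear_on V q \<and> (\<forall>x\<in>V. q x \<le> p x) \<and> (\<forall>x. x \<notin> V \<longrightarrow> q x = 0)}"
  define below where "below q r \<longleftrightarrow> (\<forall>x\<in>V. r x \<le> q x)" for q r :: "'a \<Rightarrow> real"
  have restrict: "(\<lambda>x. if x \<in> V then q x else 0) \<in> A"
    if "sublinear_on V q" "\<And>x. x \<in> V \<Longrightarrow> q x \<le> p x" for q
    using that sublinear_on_cong[OF V, of q "\<lambda>x. if x \<in> V then q x else 0"]
    unfolding A_def by auto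
  have "\<exists>q\<in>A. \<forall>r\<in>A. below q r \<longrightarrow> r = q"
  proof (rule predicate_Zorn)
    show "partial_order_on A (relation_of below A)"
    proof (rule partial_order_on_relation_ofI)
      fix q r assume qr: "q \<in> A" "r \<in> A" "below q r" "below r q"
      show "q = r"
      proof
        fix x show "q x = r x"
          using qr unfolding A_def below_def by (cases "x \<in> V") (auto intro: antisym)
      qed
    qed (auto simp: below_def intro: order_trans)
  next
    fix C assume chain: "C \<in> Chains (relation_of below A)"
    have CA: "C \<subseteq> A"
      using chain unfolding Chains_def relation_of_def by auto
    show "\<exists>u\<in>A. \<forall>a\<in>C. below a u"
    proof (cases "C = {}")
      case True
      then show ?thesis
        using restrict[OF p] by auto
    next
      case False
      let ?r = "\<lambda>x. INF c\<in>C. c x"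
      have C: "\<forall>c\<in>C. sublinear_on V c \<and> (\<forall>x\<in>V. c x \<le> p x)"
        using CA unfolding A_def by auto
      have comp: "\<forall>c\<in>C. \<forall>d\<in>C. (\<forall>x\<in>V. c x \<le> d x) \<or> (\<forall>x\<in>V. d x \<le> c x)"
        using chain unfolding Chains_def relation_of_def below_def by blast
      note inf = sublinear_on_chain_inf[OF V p False C comp]
      obtain c where c: "c \<in> C"
        using False by blast
      have "(\<lambda>x. if x \<in> V then ?r x else 0) \<in> A"
        using inf(2)[OF c] C c by (intro restrict inf(1)) (auto intro: order_trans)
      moreover have "below a (\<lambda>x. if x \<in> V then ?r x else 0)" if "a \<in> C" for a
        unfolding below_def using inf(2)[OF that] by auto
      ultimately show ?thesis
        by blast
    qed
  qed
  then obtain q where q: "q \<in> A" and min: "\<And>r. r \<in> A \<Longrightarrow> below q r \<Longrightarrow> r = q"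
    by blast
  have sub: "sublinear_on V q" and le: "\<And>x. x \<in> V \<Longrightarrow> q x \<le> p x"
    using q unfolding A_def by auto
  have add: "q (x + y) = q x + q y" if x: "x \<in> V" and y: "y \<in> V" for x y
  proof -
    define K where "K = {(complex_of_real t *\<^sub>C y, t * q y) | t. 0 \<le> t}"
    have K0: "(0, 0) \<in> K"
      unfolding K_def by (intro CollectI exI[of _ 0]) auto
    have KV: "k \<in> V \<and> s \<le> q k" if "(k, s) \<in> K" for k s
      using that sublinear_on_scale[OF V sub y] complex_vector.subspace_scale[OF V y]
      unfolding K_def by auto
    have Kadd: "(k + k', s + s') \<in> K" if ks: "(k, s) \<in> K" "(k', s') \<in> K" for k s k' s'
    proof -
      obtain t where t: "0 \<le> t" "k = complex_of_real t *\<^sub>C y" "s = t * q y"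
        using ks(1) unfolding K_def by blast
      obtain t' where t': "0 \<le> t'" "k' = complex_of_real t' *\<^sub>C y" "s' = t' * q y"
        using ks(2) unfolding K_def by blast
      show ?thesis
        unfolding K_def using t t'
        by (intro CollectI exI[of _ "t + t'"]) (auto simp: scaleC_add_left algebra_simps)
    qed
    have Kscale: "(complex_of_real a *\<^sub>C k, a * s) \<in> K" if ks: "(k, s) \<in> K" "0 \<le> a" for k s a
    proof -
      obtain t where "0 \<le> t" "k = complex_of_real t *\<^sub>C y" "s = t * q y"
        using ks(1) unfolding K_def by blast
      then show ?thesis
        unfolding K_def using ks(2)
        by (intro CollectI exI[of _ "a * t"]) (auto simp: scaleC_scaleC)
    qed
    have cone: "minorant_cone V q K"
      unfolding minorant_cone_def using K0 KV Kadd Kscale by blast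
    let ?r = "\<lambda>x. INF ks\<in>K. q (x + fst ks) - snd ks"
    note r = sublinear_on_cone_inf[OF V sub cone]
    have "(\<lambda>x. if x \<in> V then ?r x else 0) \<in> A"
      using r(2) le by (intro restrict r(1)) (auto intro: order_trans)
    then have eq: "(\<lambda>x. if x \<in> V then ?r x else 0) = q"
      using r(2) by (intro min) (auto simp: below_def)
    then have rq: "?r z = q z" if "z \<in> V" for z
      using fun_cong[OF eq, of z] that by simp
    have "(y, q y) \<in> K"
      unfolding K_def by (intro CollectI exI[of _ 1]) (auto simp: scaleC_one)
    then have neg: "q (- y) \<le> - q y"
      using r(3) rq complex_vector.subspace_neg[OF V y] by metis
    have "q x \<le> q (x + y) + q (- y)"
      using sublinear_on_add[OF sub complex_vector.subspace_add[OF V x y]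
          complex_vector.subspace_neg[OF V y]] by simp
    then show ?thesis
      using neg sublinear_on_add[OF sub x y] by linarith
  qed
  have scale: "q (complex_of_real t *\<^sub>C x) = t * q x" if x: "x \<in> V" for x t
  proof (cases "0 \<le> t")
    case True
    then show ?thesis
      by (rule sublinear_on_scale[OF V sub x])
  next
    case False
    then have "q (complex_of_real (- t) *\<^sub>C x) = - t * q x"
      by (intro sublinear_on_scale[OF V sub x]) simp
    moreover have "q (complex_of_real t *\<^sub>C x) + q (complex_of_real (- t) *\<^sub>C x) = 0"
      using add[OF complex_vector.subspace_scale[OF V x] complex_vector.subspace_scale[OF V x],
          of "complex_of_real t" "complex_of_real (- t)"] sublinear_on_zero[OF V sub]
      by (simp add: complex_vector.scale_minus_left)
    ultimately show ?thesis
      by linarith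
  qed
  show ?thesis
    using that le add scale by blast
qed

lemma linear_above_cone_below_sublinear:
  fixes K :: "('v::complex_vector \<times> real) set"
  assumes V: "complex_vector.subspace V" and q: "sublinear_on V q"
    and K: "minorant_cone V q K"
  obtains l where "\<And>x. x \<in> V \<Longrightarrow> l x \<le> q x" and "\<And>k s. (k, s) \<in> K \<Longrightarrow> s \<le> l k"
    and "\<And>x y. x \<in> V \<Longrightarrow> y \<in> V \<Longrightarrow> l (x + y) = l x + l y"
    and "\<And>x t. x \<in> V \<Longrightarrow> l (complex_of_real t *\<^sub>C x) = t * l x"
proof -
  note r = sublinear_on_cone_inf[OF V q K]
  obtain l where l: "\<And>x. x \<in> V \<Longrightarrow> l x \<le> (INF ks\<in>K. q (x + fst ks) - snd ks)"
    and add: "\<And>x y. x \<in> V \<Longrightarrow> y \<in> V \<Longrightarrow> l (x + y) = l x + l y"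
    and scale: "\<And>x t. x \<in> V \<Longrightarrow> l (complex_of_real t *\<^sub>C x) = t * l x"
    by (rule linear_below_sublinear[OF V r(1)]) blast
  have "l x \<le> q x" if "x \<in> V" for x
    using l[OF that] r(2)[OF that] by simp
  moreover have "s \<le> l k" if "(k, s) \<in> K" for k s
  proof -
    have k: "k \<in> V"
      using K that unfolding minorant_cone_def by blast
    have "l (- k) \<le> - s"
      using l[OF complex_vector.subspace_neg[OF V k]] r(3)[OF that] by simp
    moreover have "l (- k) = - l k"
      using scale[OF k, of "- 1"] by (simp add: complex_vector.scale_minus_left scaleC_one)
    ultimately show ?thesis
      by linarith
  qed
  ultimately show ?thesis
    using that add scale by blast
qed

section \<open>Normed spaces of functions and bounded operators\<close>

lemma carr_whole_space [simp]: "carr whole_space = UNIV"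
  and nrm_whole_space [simp]: "nrm whole_space = norm"
  by (simp_all add: whole_space_def)

lemma complex_normed_space_whole_space:
  "complex_normed_space (whole_space :: 'e::complex_hilbert_space nspace)"
  by unfold_locales (simp_all add: norm_scaleC norm_triangle_ineq)

context complex_normed_space
begin

lemmas carr_zero = complex_vector.subspace_0[OF subspace_carr]
lemmas carr_add = complex_vector.subspace_add[OF subspace_carr]
lemmas carr_diff = complex_vector.subspace_diff[OF subspace_carr]
lemmas carr_neg = complex_vector.subspace_neg[OF subspace_carr]
lemmas carr_scale = complex_vector.subspace_scale[OF subspace_carr]

lemma nrm_diff_commute: "x \<in> carr X \<Longrightarrow> y \<in> carr X \<Longrightarrow> nrm X (x - y) = nrm X (y - x)"
  using nrm_minus[OF carr_diff, of x y] by simp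

lemma sublinear_on_nrm: "sublinear_on (carr X) (nrm X)"
  unfolding sublinear_on_def by (simp add: nrm_triangle nrm_scaleC)

lemma openin_norm_topology:
  "openin (norm_topology X) W \<longleftrightarrow>
    W \<subseteq> carr X \<and> (\<forall>x\<in>W. \<exists>r>0. \<forall>y\<in>carr X. nrm X (y - x) < r \<longrightarrow> y \<in> W)"
proof (cases "W \<subseteq> carr X")
  case True
  have "mball x r \<subseteq> W \<longleftrightarrow> (\<forall>y\<in>carr X. nrm X (y - x) < r \<longrightarrow> y \<in> W)" if "x \<in> W" for x r
    using that True nrm_diff_commute unfolding mball_def norm_dist_def by auto
  then show ?thesis
    unfolding norm_topology_def openin_mtopology using True by blast
qed (simp add: norm_topology_def openin_mtopology)

lemma dense_in_iff:
  assumes "S \<subseteq> carr X"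
  shows "dense_in S X \<longleftrightarrow> (\<forall>x\<in>carr X. \<forall>\<epsilon>>0. \<exists>s\<in>S. nrm X (x - s) < \<epsilon>)"
proof -
  have ball: "s \<in> mball x \<epsilon> \<longleftrightarrow> nrm X (x - s) < \<epsilon>" if "x \<in> carr X" "s \<in> S" for x s \<epsilon>
    using that assms unfolding mball_def norm_dist_def by auto
  have "mtopology closure_of S = {x \<in> carr X. \<forall>\<epsilon>>0. \<exists>s\<in>S. nrm X (x - s) < \<epsilon>}"
    unfolding metric_closure_of using ball by (intro Collect_cong) blast
  then show ?thesis
    unfolding dense_in_def norm_topology_def using assms by (simp add: set_eq_iff) blast
qed

lemma holomorphic_into_continuous_nrm:
  assumes f: "holomorphic_into A X f"
  shows "continuous_on A (\<lambda>z. nrm X (f z))"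
  unfolding continuous_on_def
proof
  fix z assume z: "z \<in> A"
  obtain D where D: "D \<in> carr X"
    and lim: "((\<lambda>w. nrm X (inverse (w - z) *\<^sub>C (f w - f z) - D)) \<longlongrightarrow> 0) (at z within A)"
    using f z unfolding holomorphic_into_def by blast
  \<comment> \<open>The function \<open>?g\<close> bounds the increments: \<open>f w - f z\<close> is \<open>w - z\<close> times the difference quotient.\<close>
  let ?g = "\<lambda>w. cmod (w - z) * (nrm X (inverse (w - z) *\<^sub>C (f w - f z) - D) + nrm X D)"
  have "(?g \<longlongrightarrow> cmod (z - z) * (0 + nrm X D)) (at z within A)"
    by (intro tendsto_intros lim)
  then have g: "(?g \<longlongrightarrow> 0) (at z within A)"
    by simp
  have le: "\<bar>nrm X (f w) - nrm X (f z)\<bar> \<le> ?g w" if w: "w \<in> A" "w \<noteq> z" for w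
  proof -
    let ?q = "inverse (w - z) *\<^sub>C (f w - f z)"
    have fw: "f w \<in> carr X" and fz: "f z \<in> carr X"
      using f w z unfolding holomorphic_into_def by blast+
    have q: "?q \<in> carr X"
      by (intro carr_scale carr_diff fw fz)
    have "nrm X (f w) \<le> nrm X (f w - f z) + nrm X (f z)"
      using nrm_triangle[OF carr_diff[OF fw fz] fz] by simp
    moreover have "nrm X (f z) \<le> nrm X (f w - f z) + nrm X (f w)"
      using nrm_triangle[OF carr_diff[OF fz fw] fw] nrm_diff_commute[OF fw fz] by simp
    moreover have "nrm X (f w - f z) = cmod (w - z) * nrm X ?q"
      using w nrm_scaleC[OF q, of "w - z"] by (simp add: scaleC_scaleC scaleC_one)
    moreover have "nrm X ?q \<le> nrm X (?q - D) + nrm X D"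
      using nrm_triangle[OF carr_diff[OF q D] D] by simp
    then have "cmod (w - z) * nrm X ?q \<le> ?g w"
      by (rule mult_left_mono) simp
    ultimately show ?thesis
      by linarith
  qed
  have "((\<lambda>w. nrm X (f w) - nrm X (f z)) \<longlongrightarrow> 0) (at z within A)"
    by (rule Lim_null_comparison[OF _ g]) (auto simp: eventually_at_filter le)
  then show "((\<lambda>w. nrm X (f w)) \<longlongrightarrow> nrm X (f z)) (at z within A)"
    by (rule LIM_zero_cancel)
qed

end

lemma bounded_opsI:
  assumes "\<And>x. x \<notin> carr X \<Longrightarrow> T x = 0" "\<And>x. x \<in> carr X \<Longrightarrow> T x \<in> carr Y"
    and "\<And>x y. x \<in> carr X \<Longrightarrow> y \<in> carr X \<Longrightarrow> T (x + y) = T x + T y"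
    and "\<And>a x. x \<in> carr X \<Longrightarrow> T (a *\<^sub>C x) = a *\<^sub>C T x"
    and "\<And>x. x \<in> carr X \<Longrightarrow> nrm Y (T x) \<le> C * nrm X x"
  shows "T \<in> carr (bounded_ops X Y)"
  using assms unfolding bounded_ops_def by simp blast

lemma bounded_opsD:
  assumes "T \<in> carr (bounded_ops X Y)"
  shows "x \<notin> carr X \<Longrightarrow> T x = 0" and "x \<in> carr X \<Longrightarrow> T x \<in> carr Y"
    and "x \<in> carr X \<Longrightarrow> y \<in> carr X \<Longrightarrow> T (x + y) = T x + T y"
    and "x \<in> carr X \<Longrightarrow> T (a *\<^sub>C x) = a *\<^sub>C T x"
  using assms unfolding bounded_ops_def by auto

locale complex_normed_space_pair =
  X: complex_normed_space X + Y: complex_normed_space Y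
  for X :: "'v::complex_vector nspace" and Y :: "'w::complex_vector nspace"
begin

lemma bounded_ops_zero: "T \<in> carr (bounded_ops X Y) \<Longrightarrow> T 0 = 0"
  using bounded_opsD(4)[of T X Y 0 0] X.carr_zero by simp

lemma nrm_bounded_ops: "nrm (bounded_ops X Y) T = Sup {nrm Y (T x) | x. x \<in> carr X \<and> nrm X x \<le> 1}"
  by (simp add: bounded_ops_def)

lemma nrm_bounded_ops_le:
  assumes "0 \<le> C" and "\<And>x. x \<in> carr X \<Longrightarrow> nrm Y (T x) \<le> C * nrm X x"
  shows "nrm (bounded_ops X Y) T \<le> C"
  unfolding nrm_bounded_ops
proof (rule cSup_least)
  show "{nrm Y (T x) |x. x \<in> carr X \<and> nrm X x \<le> 1} \<noteq> {}"
    using X.carr_zero X.nrm_eq_0[OF X.carr_zero] by force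
next
  fix c assume "c \<in> {nrm Y (T x) |x. x \<in> carr X \<and> nrm X x \<le> 1}"
  then obtain x where x: "x \<in> carr X" "nrm X x \<le> 1" "c = nrm Y (T x)"
    by blast
  then show "c \<le> C"
    using assms(2)[OF x(1)] mult_left_mono[OF x(2) assms(1)] by simp
qed

lemma nrm_bounded_ops_apply_unit:
  assumes T: "T \<in> carr (bounded_ops X Y)" and x: "x \<in> carr X" "nrm X x \<le> 1"
  shows "nrm Y (T x) \<le> nrm (bounded_ops X Y) T"
  unfolding nrm_bounded_ops
proof (rule cSup_upper)
  obtain C where C: "\<And>x. x \<in> carr X \<Longrightarrow> nrm Y (T x) \<le> C * nrm X x"
    using T unfolding bounded_ops_def by fastforce
  have "nrm Y (T y) \<le> \<bar>C\<bar>" if "y \<in> carr X" "nrm X y \<le> 1" for y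
  proof -
    have "C * nrm X y \<le> \<bar>C\<bar> * 1"
      using that X.nrm_nonneg[OF that(1)] by (intro mult_mono) auto
    then show ?thesis
      using C[OF that(1)] by simp
  qed
  then show "bdd_above {nrm Y (T x) |x. x \<in> carr X \<and> nrm X x \<le> 1}"
    by (intro bdd_aboveI[of _ "\<bar>C\<bar>"]) blast
qed (use x in blast)

lemma nrm_bounded_ops_nonneg: "T \<in> carr (bounded_ops X Y) \<Longrightarrow> 0 \<le> nrm (bounded_ops X Y) T"
  using nrm_bounded_ops_apply_unit[of T 0] X.carr_zero X.nrm_eq_0[OF X.carr_zero]
    bounded_ops_zero[of T] Y.nrm_eq_0[OF Y.carr_zero] by simp

lemma nrm_bounded_ops_apply:
  assumes T: "T \<in> carr (bounded_ops X Y)" and x: "x \<in> carr X"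
  shows "nrm Y (T x) \<le> nrm (bounded_ops X Y) T * nrm X x"
proof (cases "x = 0")
  case True
  then show ?thesis
    using bounded_ops_zero[OF T] X.nrm_eq_0[OF X.carr_zero] Y.nrm_eq_0[OF Y.carr_zero] by simp
next
  case False
  then have pos: "0 < nrm X x"
    using X.nrm_eq_0[OF x] X.nrm_nonneg[OF x] by linarith
  let ?a = "complex_of_real (inverse (nrm X x))"
  have "nrm Y (T (?a *\<^sub>C x)) \<le> nrm (bounded_ops X Y) T"
    using pos by (intro nrm_bounded_ops_apply_unit[OF T X.carr_scale[OF x]])
      (simp add: X.nrm_scaleC[OF x] del: of_real_inverse)
  moreover have "nrm Y (T (?a *\<^sub>C x)) = inverse (nrm X x) * nrm Y (T x)"
    using pos by (simp add: bounded_opsD(4)[OF T x] Y.nrm_scaleC[OF bounded_opsD(2)[OF T x]]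
        del: of_real_inverse)
  ultimately have "inverse (nrm X x) * nrm Y (T x) \<le> nrm (bounded_ops X Y) T"
    by simp
  then show ?thesis
    using pos by (simp add: field_simps)
qed

lemma complex_normed_space_bounded_ops: "complex_normed_space (bounded_ops X Y)"
proof
  show "complex_vector.subspace (carr (bounded_ops X Y))"
  proof (rule complex_vector.subspaceI)
    show "0 \<in> carr (bounded_ops X Y)"
      using Y.carr_zero Y.nrm_eq_0[OF Y.carr_zero] by (intro bounded_opsI[where C = 0]) auto
  next
    fix S T assume S: "S \<in> carr (bounded_ops X Y)" and T: "T \<in> carr (bounded_ops X Y)"
    show "S + T \<in> carr (bounded_ops X Y)"
    proof (rule bounded_opsI[where C = "nrm (bounded_ops X Y) S + nrm (bounded_ops X Y) T"])
      fix x assume x: "x \<in> carr X"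
      show "nrm Y ((S + T) x) \<le> (nrm (bounded_ops X Y) S + nrm (bounded_ops X Y) T) * nrm X x"
        using nrm_bounded_ops_apply[OF S x] nrm_bounded_ops_apply[OF T x]
          Y.nrm_triangle[OF bounded_opsD(2)[OF S x] bounded_opsD(2)[OF T x]]
        by (simp add: algebra_simps)
    qed (simp_all add: bounded_opsD[OF S] bounded_opsD[OF T] Y.carr_add scaleC_add_right)
  next
    fix a T assume T: "T \<in> carr (bounded_ops X Y)"
    show "a *\<^sub>C T \<in> carr (bounded_ops X Y)"
    proof (rule bounded_opsI[where C = "cmod a * nrm (bounded_ops X Y) T"])
      fix x assume x: "x \<in> carr X"
      show "nrm Y ((a *\<^sub>C T) x) \<le> cmod a * nrm (bounded_ops X Y) T * nrm X x"
        using mult_left_mono[OF nrm_bounded_ops_apply[OF T x], of "cmod a"]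
        by (simp add: scaleC_fun_def Y.nrm_scaleC[OF bounded_opsD(2)[OF T x]] mult.assoc)
    qed (simp_all add: scaleC_fun_def bounded_opsD[OF T] Y.carr_scale scaleC_add_right
        scaleC_scaleC mult.commute)
  qed
  fix T assume T: "T \<in> carr (bounded_ops X Y)"
  show "nrm (bounded_ops X Y) T = 0 \<longleftrightarrow> T = 0"
  proof
    assume 0: "nrm (bounded_ops X Y) T = 0"
    have "T x = 0" for x
    proof (cases "x \<in> carr X")
      case True
      have "nrm Y (T x) \<le> 0"
        using nrm_bounded_ops_apply[OF T True] 0 by simp
      then show ?thesis
        using Y.nrm_eq_0[OF bounded_opsD(2)[OF T True]] Y.nrm_nonneg[OF bounded_opsD(2)[OF T True]]
        by linarith
    qed (rule bounded_opsD(1)[OF T])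
    then show "T = 0"
      by (simp add: fun_eq_iff)
  next
    assume "T = 0"
    then have "nrm (bounded_ops X Y) T \<le> 0"
      using Y.nrm_eq_0[OF Y.carr_zero] by (intro nrm_bounded_ops_le) auto
    then show "nrm (bounded_ops X Y) T = 0"
      using nrm_bounded_ops_nonneg[OF T] by linarith
  qed
  have le: "nrm (bounded_ops X Y) (a *\<^sub>C T) \<le> cmod a * nrm (bounded_ops X Y) T"
    if T: "T \<in> carr (bounded_ops X Y)" for a T
  proof (rule nrm_bounded_ops_le)
    fix x assume x: "x \<in> carr X"
    show "nrm Y ((a *\<^sub>C T) x) \<le> cmod a * nrm (bounded_ops X Y) T * nrm X x"
      using mult_left_mono[OF nrm_bounded_ops_apply[OF T x], of "cmod a"]
      by (simp add: scaleC_fun_def Y.nrm_scaleC[OF bounded_opsD(2)[OF T x]] mult.assoc)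
  qed (simp add: nrm_bounded_ops_nonneg[OF T])
  show "nrm (bounded_ops X Y) (a *\<^sub>C T) = cmod a * nrm (bounded_ops X Y) T" for a
  proof (rule antisym[OF le[OF T]])
    show "cmod a * nrm (bounded_ops X Y) T \<le> nrm (bounded_ops X Y) (a *\<^sub>C T)"
    proof (cases "a = 0")
      case True
      have "0 \<in> carr (bounded_ops X Y)"
        using Y.carr_zero Y.nrm_eq_0[OF Y.carr_zero] by (intro bounded_opsI[where C = 0]) auto
      then show ?thesis
        using True nrm_bounded_ops_nonneg[of 0] by simp
    next
      case False
      have "a *\<^sub>C T \<in> carr (bounded_ops X Y)"
        by (rule complex_vector.subspace_scale) fact+
      from le[OF this, of "inverse a"] False
      have "nrm (bounded_ops X Y) T \<le> inverse (cmod a) * nrm (bounded_ops X Y) (a *\<^sub>C T)"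
        by (simp add: scaleC_scaleC scaleC_one norm_inverse)
      then show ?thesis
        using False by (simp add: field_simps)
    qed
  qed
  fix S assume S: "S \<in> carr (bounded_ops X Y)"
  show "nrm (bounded_ops X Y) (T + S) \<le> nrm (bounded_ops X Y) T + nrm (bounded_ops X Y) S"
  proof (rule nrm_bounded_ops_le)
    fix x assume x: "x \<in> carr X"
    show "nrm Y ((T + S) x) \<le> (nrm (bounded_ops X Y) T + nrm (bounded_ops X Y) S) * nrm X x"
      using nrm_bounded_ops_apply[OF S x] nrm_bounded_ops_apply[OF T x]
        Y.nrm_triangle[OF bounded_opsD(2)[OF T x] bounded_opsD(2)[OF S x]]
      by (simp add: algebra_simps)
  qed (simp add: nrm_bounded_ops_nonneg S T)
qed

end

lemma (in complex_normed_space) dual_pair: "complex_normed_space_pair X (whole_space :: complex nspace)"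
  by (simp add: complex_normed_space_pair_def complex_normed_space_axioms
      complex_normed_space_whole_space)

lemma (in complex_normed_space) complex_normed_space_dual: "complex_normed_space (dual_space X)"
  unfolding dual_space_def
  by (rule complex_normed_space_pair.complex_normed_space_bounded_ops[OF dual_pair])

lemma dual_spaceD:
  assumes "\<phi> \<in> carr (dual_space X)"
  shows "x \<notin> carr X \<Longrightarrow> \<phi> x = 0"
    and "x \<in> carr X \<Longrightarrow> y \<in> carr X \<Longrightarrow> \<phi> (x + y) = \<phi> x + \<phi> y"
    and "x \<in> carr X \<Longrightarrow> \<phi> (a *\<^sub>C x) = a * \<phi> x"
  using bounded_opsD[OF assms[unfolded dual_space_def]] by (auto simp: scaleC_complex_def)

lemma (in complex_normed_space) dual_space_apply:
  assumes "\<phi> \<in> carr (dual_space X)" "x \<in> carr X"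
  shows "cmod (\<phi> x) \<le> nrm (dual_space X) \<phi> * nrm X x"
  using complex_normed_space_pair.nrm_bounded_ops_apply[OF dual_pair assms[unfolded dual_space_def]]
  by (simp add: dual_space_def)

section \<open>Separation of a point from a subspace\<close>

text \<open>
  The cone spanned by \<open>(x0 - m, \<delta>)\<close> for \<open>m\<close> in \<open>M\<close>, together with \<open>(- m, 0)\<close>, lies below the
  norm. A real linear \<open>l\<close> above the cone and below the norm vanishes on \<open>M\<close> and satisfies
  \<open>\<delta> \<le> l x0\<close>. It is the real part of the complex linear functional \<open>l x - \<i> * l (\<i> x)\<close>, which
  vanishes on \<open>M\<close> because \<open>M\<close> is a complex subspace.
\<close>

theorem (in complex_normed_space) hahn_banach_separation:
  assumes M: "complex_vector.subspace M" "M \<subseteq> carr X" and x0: "x0 \<in> carr X"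
    and \<delta>: "0 < \<delta>" "\<And>m. m \<in> M \<Longrightarrow> \<delta> \<le> nrm X (x0 - m)"
  obtains F where "F \<in> carr (dual_space X)" "\<And>m. m \<in> M \<Longrightarrow> F m = 0" "F x0 \<noteq> 0"
proof -
  define K where "K = {(complex_of_real t *\<^sub>C x0 - m, t * \<delta>) | t m. 0 \<le> t \<and> m \<in> M}"
  have memK: "(complex_of_real t *\<^sub>C x0 - m, t * \<delta>) \<in> K" if "0 \<le> t" "m \<in> M" for t m
    using that unfolding K_def by blast
  have cone: "minorant_cone (carr X) (nrm X) K"
    unfolding minorant_cone_def
  proof (intro conjI allI impI)
    show "(0, 0) \<in> K"
      using memK[of 0 0] complex_vector.subspace_0[OF M(1)] by simp
  next
    fix k s assume "(k, s) \<in> K"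
    then obtain t m where tm: "0 \<le> t" "m \<in> M" "k = complex_of_real t *\<^sub>C x0 - m" "s = t * \<delta>"
      unfolding K_def by blast
    show k: "k \<in> carr X"
      unfolding tm using tm(2) M(2) x0 by (intro carr_diff carr_scale) auto
    show "s \<le> nrm X k"
    proof (cases "t = 0")
      case True
      then show ?thesis
        using tm nrm_nonneg[OF k] by simp
    next
      case False
      let ?m = "complex_of_real (inverse t) *\<^sub>C m"
      have m: "?m \<in> M"
        using complex_vector.subspace_scale[OF M(1) tm(2)] .
      have "k = complex_of_real t *\<^sub>C (x0 - ?m)"
        unfolding tm using False
        by (simp add: complex_vector.scale_right_diff_distrib scaleC_scaleC scaleC_one)
      then have "nrm X k = t * nrm X (x0 - ?m)"
        using nrm_scaleC[OF carr_diff[OF x0]] m M(2) tm(1) by auto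
      then show ?thesis
        using mult_left_mono[OF \<delta>(2)[OF m] tm(1)] tm(4) by simp
    qed
  next
    fix k s k' s' assume "(k, s) \<in> K" "(k', s') \<in> K"
    then obtain t m t' m' where "0 \<le> t" "m \<in> M" "k = complex_of_real t *\<^sub>C x0 - m" "s = t * \<delta>"
      "0 \<le> t'" "m' \<in> M" "k' = complex_of_real t' *\<^sub>C x0 - m'" "s' = t' * \<delta>"
      unfolding K_def by blast
    moreover from this have "(complex_of_real (t + t') *\<^sub>C x0 - (m + m'), (t + t') * \<delta>) \<in> K"
      by (intro memK complex_vector.subspace_add[OF M(1)]) auto
    ultimately show "(k + k', s + s') \<in> K"
      by (simp add: scaleC_add_left add_diff_add distrib_right)
  next
    fix k s and a :: real assume "(k, s) \<in> K" and a: "0 \<le> a"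
    then obtain t m where "0 \<le> t" "m \<in> M" "k = complex_of_real t *\<^sub>C x0 - m" "s = t * \<delta>"
      unfolding K_def by blast
    then show "(complex_of_real a *\<^sub>C k, a * s) \<in> K"
      using memK[of "a * t" "complex_of_real a *\<^sub>C m"] a complex_vector.subspace_scale[OF M(1)]
      by (simp add: complex_vector.scale_right_diff_distrib scaleC_scaleC mult.assoc)
  qed
  obtain l where le: "\<And>x. x \<in> carr X \<Longrightarrow> l x \<le> nrm X x"
    and ge: "\<And>k s. (k, s) \<in> K \<Longrightarrow> s \<le> l k"
    and add: "\<And>x y. x \<in> carr X \<Longrightarrow> y \<in> carr X \<Longrightarrow> l (x + y) = l x + l y"
    and scale: "\<And>x t. x \<in> carr X \<Longrightarrow> l (complex_of_real t *\<^sub>C x) = t * l x"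
    by (rule linear_above_cone_below_sublinear[OF subspace_carr sublinear_on_nrm cone]) blast
  have neg: "l (- x) = - l x" if "x \<in> carr X" for x
    using scale[OF that, of "-1"] by (simp add: complex_vector.scale_minus_left scaleC_one)
  have abs: "\<bar>l x\<bar> \<le> nrm X x" if "x \<in> carr X" for x
    using le[OF that] le[OF carr_neg[OF that]] neg[OF that] nrm_minus[OF that] by linarith
  have lM: "l m = 0" if m: "m \<in> M" for m
  proof -
    have "0 \<le> l (- m)" "0 \<le> l m"
      using ge[OF memK[of 0 m]] ge[OF memK[of 0 "- m"]] m complex_vector.subspace_neg[OF M(1) m]
      by simp_all
    then show ?thesis
      using neg[of m] m M(2) by auto
  qed
  have lx0: "\<delta> \<le> l x0"
    using ge[OF memK[of 1 0]] complex_vector.subspace_0[OF M(1)] by (simp add: scaleC_one)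
  define F where
    "F x = (if x \<in> carr X then complex_of_real (l x) - \<i> * complex_of_real (l (\<i> *\<^sub>C x)) else 0)" for x
  have F_add: "F (x + y) = F x + F y" if "x \<in> carr X" "y \<in> carr X" for x y
    using that by (simp add: F_def carr_add carr_scale add scaleC_add_right algebra_simps)
  have F_real: "F (complex_of_real t *\<^sub>C x) = t * F x" if "x \<in> carr X" for t x
  proof -
    have "\<i> *\<^sub>C complex_of_real t *\<^sub>C x = complex_of_real t *\<^sub>C \<i> *\<^sub>C x"
      by (simp add: scaleC_scaleC mult.commute)
    then show ?thesis
      unfolding F_def using that by (simp add: carr_scale scale algebra_simps del: complex_vector.scale_scale)
  qed
  have F_i: "F (\<i> *\<^sub>C x) = \<i> * F x" if "x \<in> carr X" for x
  proof -
    have "\<i> *\<^sub>C \<i> *\<^sub>C x = - x"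
      by (simp add: scaleC_scaleC complex_vector.scale_minus_left scaleC_one)
    then show ?thesis
      using that by (simp add: F_def carr_scale neg algebra_simps)
  qed
  have F_scale: "F (a *\<^sub>C x) = a * F x" if x: "x \<in> carr X" for a x
  proof -
    have "a *\<^sub>C x = complex_of_real (Re a) *\<^sub>C x + complex_of_real (Im a) *\<^sub>C \<i> *\<^sub>C x"
      unfolding scaleC_scaleC scaleC_add_left[symmetric]
      by (rule arg_cong[where f = "\<lambda>c. c *\<^sub>C x"]) (simp add: complex_eq_iff)
    then have "F (a *\<^sub>C x) = (complex_of_real (Re a) + \<i> * complex_of_real (Im a)) * F x"
      using x by (simp add: F_add F_real F_i carr_scale algebra_simps del: complex_vector.scale_scale)
    then show ?thesis
      by (simp add: complex_eq[symmetric])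
  qed
  \<comment> \<open>The sharp constant is \<open>1\<close>; the crude bound by real and imaginary part suffices here.\<close>
  have F_bound: "cmod (F x) \<le> 2 * nrm X x" if x: "x \<in> carr X" for x
  proof -
    have "cmod (F x) \<le> \<bar>l x\<bar> + \<bar>l (\<i> *\<^sub>C x)\<bar>"
      using norm_triangle_ineq4[of "complex_of_real (l x)" "\<i> * complex_of_real (l (\<i> *\<^sub>C x))"] x
      by (simp add: F_def norm_mult)
    then show ?thesis
      using abs[OF x] abs[OF carr_scale[OF x, of \<i>]] nrm_scaleC[OF x, of \<i>] by simp
  qed
  have "F \<in> carr (dual_space X)"
    unfolding dual_space_def using F_add F_scale F_bound
    by (intro bounded_opsI[where C = 2]) (auto simp: F_def[of x for x] scaleC_complex_def)
  moreover have "F m = 0" if "m \<in> M" for m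
    using that M(2) lM complex_vector.subspace_scale[OF M(1) that] by (auto simp: F_def)
  moreover have "Re (F x0) \<noteq> 0"
    using x0 lx0 \<delta>(1) by (simp add: F_def)
  then have "F x0 \<noteq> 0"
    by auto
  ultimately show ?thesis
    using that by blast
qed

section \<open>The topology of locally uniform convergence\<close>

text \<open>
  This neighbourhood of \<open>0\<close> turns continuity of an inclusion into a space of holomorphic
  functions into a norm bound for evaluation at \<open>z\<close>, in \<open>point_evaluation_bounded\<close>.
\<close>

lemma openin_Hol_nbhd_point:
  fixes A :: "complex set"
  assumes z: "z \<in> A"
  shows "openin (Hol_topology A) {g \<in> Hol A. norm (g z :: 'e::complex_hilbert_space) < 1}"
  unfolding openin_Hol_topology
proof (intro conjI ballI)
  fix f :: "complex \<Rightarrow> 'e" assume f: "f \<in> {g \<in> Hol A. norm (g z) < 1}"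
  have "norm (g z) < 1" if "norm (g z - f z) < 1 - norm (f z)" for g
    using that norm_triangle_ineq2[of "g z" "f z"] by linarith
  then show "\<exists>K \<epsilon>. compact K \<and> K \<subseteq> A \<and> 0 < \<epsilon> \<and>
      {g \<in> Hol A. \<forall>w\<in>K. norm (g w - f w) < \<epsilon>} \<subseteq> {g \<in> Hol A. norm (g z) < 1}"
    using f z by (intro exI[of _ "{z}"] exI[of _ "1 - norm (f z)"]) auto
qed blast

lemma topspace_Hol_topology: "topspace (Hol_topology A) = Hol A"
proof
  have "openin (Hol_topology A) (Hol A)"
    unfolding openin_Hol_topology by (auto intro!: exI[of _ "{}"] exI[of _ "1::real"])
  then show "Hol A \<subseteq> topspace (Hol_topology A)"
    by (rule openin_subset)
  show "topspace (Hol_topology A) \<subseteq> Hol A"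
    using openin_topspace[of "Hol_topology A"] unfolding openin_Hol_topology by blast
qed

lemma (in complex_normed_space) topspace_norm_topology: "topspace (norm_topology X) = carr X"
  by (simp add: norm_topology_def)

lemma continuous_map_Hol_topologyI:
  fixes X :: "(complex \<Rightarrow> 'e::complex_hilbert_space) nspace"
  assumes X: "complex_normed_space X" and Hol: "carr X \<subseteq> Hol A"
    and bound: "\<And>K. compact K \<Longrightarrow> K \<subseteq> A \<Longrightarrow>
      \<exists>C. \<forall>f\<in>carr X. \<forall>z\<in>K. norm (f z) \<le> C * nrm X f"
  shows "continuous_map (norm_topology X) (Hol_topology A) (\<lambda>f. f)"
proof -
  interpret complex_normed_space X
    by (rule X)
  have "openin (norm_topology X) {f \<in> carr X. f \<in> W}" if W: "openin (Hol_topology A) W" for W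
    unfolding openin_norm_topology
  proof (intro conjI ballI)
    fix f assume f: "f \<in> {f \<in> carr X. f \<in> W}"
    then obtain K \<epsilon> where K: "compact K" "K \<subseteq> A" and \<epsilon>: "0 < \<epsilon>"
      and sub: "{g \<in> Hol A. \<forall>z\<in>K. norm (g z - f z) < \<epsilon>} \<subseteq> W"
      using W unfolding openin_Hol_topology by blast
    obtain C where C: "\<And>g z. g \<in> carr X \<Longrightarrow> z \<in> K \<Longrightarrow> norm (g z) \<le> C * nrm X g"
      using bound[OF K] by blast
    have "g \<in> W" if g: "g \<in> carr X" "nrm X (g - f) < \<epsilon> / (\<bar>C\<bar> + 1)" for g
    proof -
      have gf: "g - f \<in> carr X"
        using g f by (intro carr_diff) auto
      have "norm (g z - f z) < \<epsilon>" if z: "z \<in> K" for z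
      proof -
        have "norm (g z - f z) \<le> C * nrm X (g - f)"
          using C[OF gf z] by simp
        also have "\<dots> \<le> (\<bar>C\<bar> + 1) * nrm X (g - f)"
          using nrm_nonneg[OF gf] by (intro mult_right_mono) auto
        also have "\<dots> < \<epsilon>"
          using g(2) by (simp add: pos_less_divide_eq mult.commute)
        finally show ?thesis .
      qed
      then show ?thesis
        using sub g(1) Hol by blast
    qed
    then show "\<exists>r>0. \<forall>g\<in>carr X. nrm X (g - f) < r \<longrightarrow> g \<in> {f \<in> carr X. f \<in> W}"
      using \<epsilon> by (intro exI[of _ "\<epsilon> / (\<bar>C\<bar> + 1)"]) auto
  qed blast
  then show ?thesis
    unfolding continuous_map_def topspace_norm_topology topspace_Hol_topology using Hol by auto
qed

lemma point_evaluation_bounded: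
  fixes X :: "(complex \<Rightarrow> 'e::complex_hilbert_space) nspace"
  assumes X: "complex_normed_space X"
    and cont: "continuous_map (norm_topology X) (Hol_topology A) (\<lambda>f. f)" and z: "z \<in> A"
  obtains C where "\<And>f. f \<in> carr X \<Longrightarrow> norm (f z) \<le> C * nrm X f"
proof -
  interpret complex_normed_space X
    by (rule X)
  have "openin (norm_topology X) {f \<in> carr X. f \<in> {g \<in> Hol A. norm (g z) < 1}}"
    using openin_continuous_map_preimage[OF cont openin_Hol_nbhd_point[OF z]]
    by (simp add: topspace_norm_topology)
  moreover have "0 \<in> {f \<in> carr X. f \<in> {g \<in> Hol A. norm (g z) < 1}}"
    using cont carr_zero unfolding continuous_map_def topspace_norm_topology topspace_Hol_topology
    by auto
  ultimately have "\<exists>r>0. \<forall>f\<in>carr X. nrm X (f - 0) < r \<longrightarrow>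
      f \<in> {f \<in> carr X. f \<in> {g \<in> Hol A. norm (g z) < 1}}"
    unfolding openin_norm_topology by blast
  then obtain r where r: "r > 0"
    and small: "\<And>f. f \<in> carr X \<Longrightarrow> nrm X f < r \<Longrightarrow> norm (f z) < 1"
    by auto
  have "norm (f z) \<le> 2 / r * nrm X f" if f: "f \<in> carr X" for f
  proof (cases "f = 0")
    case True
    then show ?thesis
      using nrm_eq_0[OF f] by simp
  next
    case False
    then have pos: "0 < nrm X f"
      using nrm_eq_0[OF f] nrm_nonneg[OF f] by linarith
    \<comment> \<open>The factor \<open>a\<close> moves \<open>f\<close> to norm \<open>r / 2\<close>, inside the ball of radius \<open>r\<close>.\<close>
    define a where "a = r / (2 * nrm X f)"
    have a: "0 < a"
      unfolding a_def using r pos by simp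
    have "nrm X (complex_of_real a *\<^sub>C f) = a * nrm X f"
      using nrm_scaleC[OF f] a by simp
    then have "nrm X (complex_of_real a *\<^sub>C f) < r"
      using r pos by (simp add: a_def)
    then have "norm ((complex_of_real a *\<^sub>C f) z) < 1"
      by (rule small[OF carr_scale[OF f]])
    then have "a * norm (f z) < 1"
      using a by (simp add: scaleC_fun_def norm_scaleC)
    then show ?thesis
      using r pos unfolding a_def by (simp add: field_simps)
  qed
  then show ?thesis
    using that by blast
qed

section \<open>The dual model\<close>

text \<open>
  The data from which \<open>\<U>\<close> and \<open>B'\<close> can be formed: holomorphy of \<open>\<Psi>\<close> gives the values of \<open>\<U>\<close>, and
  density gives its injectivity.
\<close>

locale dual_model_data =
  B: complex_normed_space B for B :: "(complex \<Rightarrow> 'e::complex_hilbert_space) nspace" +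
  fixes \<Omega>' :: "complex set" and \<Psi> :: "complex \<Rightarrow> 'e \<Rightarrow> (complex \<Rightarrow> 'e)"
  assumes hol: "holomorphic_into (cnj ` \<Omega>') (bounded_ops whole_space B) \<Psi>"
    and total: "cond_A2 B \<Omega>' \<Psi>"
begin

abbreviation "\<U> \<equiv> dual_map \<Omega>' \<Psi>"
abbreviation "D \<equiv> dual_space B"
abbreviation "B' \<equiv> dual_model B \<Omega>' \<Psi>"
abbreviation "Ops \<equiv> bounded_ops (whole_space :: 'e nspace) B"

sublocale D: complex_normed_space D
  by (rule B.complex_normed_space_dual)

sublocale EB: complex_normed_space_pair "whole_space :: 'e nspace" B
  by (simp add: complex_normed_space_pair_def complex_normed_space_whole_space
      B.complex_normed_space_axioms)

sublocale Ops: complex_normed_space Ops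
  by (rule EB.complex_normed_space_bounded_ops)

lemma Psi_carr: "l \<in> \<Omega>' \<Longrightarrow> \<Psi> (cnj l) \<in> carr Ops"
  using hol unfolding holomorphic_into_def by blast

lemma Psi_in: "l \<in> \<Omega>' \<Longrightarrow> \<Psi> (cnj l) e \<in> carr B"
  using bounded_opsD(2)[OF Psi_carr] by simp

lemma functional_operator_riesz:
  assumes \<phi>: "\<phi> \<in> carr D" and T: "T \<in> carr Ops"
  obtains v where "\<And>e. \<phi> (T e) = cinner e v"
proof -
  have "\<exists>v. \<forall>e. \<phi> (T e) = cinner e v"
  proof (rule riesz_representation)
    fix x
    have "cmod (\<phi> (T x)) \<le> nrm D \<phi> * nrm B (T x)"
      by (intro B.dual_space_apply \<phi> bounded_opsD(2)[OF T]) simp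
    also have "\<dots> \<le> nrm D \<phi> * (nrm Ops T * norm x)"
      using EB.nrm_bounded_ops_apply[OF T] by (intro mult_left_mono D.nrm_nonneg[OF \<phi>]) simp
    finally show "cmod (\<phi> (T x)) \<le> nrm D \<phi> * nrm Ops T * norm x"
      by (simp add: mult.assoc)
  qed (use dual_spaceD[OF \<phi>] bounded_opsD[OF T] in simp_all)
  then show ?thesis
    using that by blast
qed

text \<open>
  Testing \<open>\<phi> \<circ> T\<close> at \<open>v\<close> itself gives \<open>(norm v)\<^sup>2\<close>. With \<open>T\<close> a value of \<open>\<Psi>\<close> this bounds the
  functions in \<open>B'\<close>; with \<open>T\<close> the error of a difference quotient of \<open>\<Psi>\<close> it proves that they are holomorphic.
\<close>

lemma norm_riesz_vector_le:
  assumes \<phi>: "\<phi> \<in> carr D" and T: "T \<in> carr Ops" and v: "\<And>e. \<phi> (T e) = cinner e v"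
  shows "norm v \<le> nrm D \<phi> * nrm Ops T"
proof (cases "v = 0")
  case True
  then show ?thesis
    using D.nrm_nonneg[OF \<phi>] Ops.nrm_nonneg[OF T] by simp
next
  case False
  have "(norm v)\<^sup>2 = cmod (\<phi> (T v))"
    by (simp add: v cinner_self norm_power)
  also have "\<dots> \<le> nrm D \<phi> * nrm B (T v)"
    by (intro B.dual_space_apply \<phi> bounded_opsD(2)[OF T]) simp
  also have "\<dots> \<le> nrm D \<phi> * (nrm Ops T * norm v)"
    using EB.nrm_bounded_ops_apply[OF T] by (intro mult_left_mono D.nrm_nonneg[OF \<phi>]) simp
  finally have "norm v * norm v \<le> (nrm D \<phi> * nrm Ops T) * norm v"
    by (simp add: power2_eq_square mult.assoc)
  then show ?thesis
    using False by simp
qed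

text \<open>
  Only the values of \<open>\<phi>\<close> on the vectors \<open>\<Psi> (cnj l) e\<close> enter, and there the compositions
  \<open>adjoint_op L \<phi>\<close> and \<open>adjoint_op (mult_op B) \<phi>\<close> can be computed.
\<close>

lemma dual_map_eqI:
  assumes "\<And>l e. l \<in> \<Omega>' \<Longrightarrow> \<phi> (\<Psi> (cnj l) e) = cinner e (g l)"
    and "\<And>l. l \<notin> \<Omega>' \<Longrightarrow> g l = 0"
  shows "\<U> \<phi> = g"
proof
  fix l
  show "\<U> \<phi> l = g l"
  proof (cases "l \<in> \<Omega>'")
    case True
    have "(THE v. \<forall>e. \<phi> (\<Psi> (cnj l) e) = cinner e v) = g l"
      using assms(1)[OF True] by (intro the_equality) (auto intro: cinner_eqI)
    then show ?thesis
      using True by (simp add: dual_map_def)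
  qed (simp add: dual_map_def assms(2))
qed

lemma cinner_dual_map:
  assumes \<phi>: "\<phi> \<in> carr D" and l: "l \<in> \<Omega>'"
  shows "\<phi> (\<Psi> (cnj l) e) = cinner e (\<U> \<phi> l)"
proof -
  obtain v where v: "\<And>e. \<phi> (\<Psi> (cnj l) e) = cinner e v"
    using functional_operator_riesz[OF \<phi> Psi_carr[OF l]] by blast
  have "(THE v. \<forall>e. \<phi> (\<Psi> (cnj l) e) = cinner e v) = v"
    using v by (intro the_equality) (auto intro: cinner_eqI)
  then show ?thesis
    using v l by (simp add: dual_map_def)
qed

lemma dual_map_outside: "l \<notin> \<Omega>' \<Longrightarrow> \<U> \<phi> l = 0"
  by (simp add: dual_map_def)

lemma dual_map_add: "\<phi> \<in> carr D \<Longrightarrow> \<psi> \<in> carr D \<Longrightarrow> \<U> (\<phi> + \<psi>) = \<U> \<phi> + \<U> \<psi>"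
  by (rule dual_map_eqI) (simp_all add: cinner_dual_map cinner_add_right dual_map_outside)

lemma dual_map_scale: "\<phi> \<in> carr D \<Longrightarrow> \<U> (a *\<^sub>C \<phi>) = cnj a *\<^sub>C \<U> \<phi>"
  by (rule dual_map_eqI)
    (simp_all add: scaleC_fun_def scaleC_complex_def cinner_dual_map cinner_scaleC_right
      dual_map_outside)

lemma dual_map_zero: "\<U> 0 = 0"
  using dual_map_scale[OF D.carr_zero, of 0] by simp

lemma dual_map_diff:
  assumes "\<phi> \<in> carr D" "\<psi> \<in> carr D"
  shows "\<U> (\<phi> - \<psi>) = \<U> \<phi> - \<U> \<psi>"
  using dual_map_add[OF D.carr_diff[OF assms] assms(2)] by (simp add: algebra_simps)

text \<open>
  The kernel of \<open>\<phi>\<close> is closed and contains the span of the vectors \<open>\<Psi> (cnj l) e\<close>, which is dense.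
\<close>

lemma dual_map_eq_0_imp:
  assumes \<phi>: "\<phi> \<in> carr D" and 0: "\<U> \<phi> = 0"
  shows "\<phi> = 0"
proof -
  let ?G = "{\<Psi> (cnj l) e | e l. l \<in> \<Omega>'}"
  have "complex_vector.subspace {x \<in> carr B. \<phi> x = 0}"
    using dual_spaceD(3)[OF \<phi> B.carr_zero, of 0] dual_spaceD[OF \<phi>] B.carr_zero
    by (intro complex_vector.subspaceI) (auto intro: B.carr_add B.carr_scale)
  moreover have "?G \<subseteq> {x \<in> carr B. \<phi> x = 0}"
    using Psi_in cinner_dual_map[OF \<phi>] cinner_scaleC_right[of _ 0] by (auto simp: 0)
  ultimately have span: "complex_vector.span ?G \<subseteq> {x \<in> carr B. \<phi> x = 0}"
    by (intro complex_vector.span_minimal)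
  have dense: "\<forall>x\<in>carr B. \<forall>\<epsilon>>0. \<exists>s\<in>complex_vector.span ?G. nrm B (x - s) < \<epsilon>"
    using total span B.dense_in_iff[of "complex_vector.span ?G"] unfolding cond_A2_def by blast
  have "\<phi> x = 0" if x: "x \<in> carr B" for x
  proof (rule ccontr)
    assume nz: "\<phi> x \<noteq> 0"
    define \<epsilon> where "\<epsilon> = cmod (\<phi> x) / (nrm D \<phi> + 1)"
    have "\<epsilon> > 0"
      unfolding \<epsilon>_def using nz D.nrm_nonneg[OF \<phi>] by simp
    then obtain s where s: "s \<in> complex_vector.span ?G" "nrm B (x - s) < \<epsilon>"
      using dense x by blast
    have sB: "s \<in> carr B" "\<phi> s = 0"
      using s(1) span by auto
    have xs: "x - s \<in> carr B"
      by (rule B.carr_diff[OF x sB(1)])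
    have "\<phi> x = \<phi> (x - s)"
      using dual_spaceD(2)[OF \<phi> xs sB(1)] sB(2) by simp
    then have "cmod (\<phi> x) \<le> nrm D \<phi> * nrm B (x - s)"
      using B.dual_space_apply[OF \<phi> xs] by simp
    also have "\<dots> \<le> (nrm D \<phi> + 1) * nrm B (x - s)"
      using B.nrm_nonneg[OF xs] by (intro mult_right_mono) auto
    also have "\<dots> < cmod (\<phi> x)"
      using s(2) D.nrm_nonneg[OF \<phi>] unfolding \<epsilon>_def by (simp add: pos_less_divide_eq mult.commute)
    finally show False
      by simp
  qed
  then show ?thesis
    using dual_spaceD(1)[OF \<phi>] by (auto simp: fun_eq_iff)
qed

lemma inj_on_dual_map: "inj_on \<U> (carr D)"
proof (rule inj_onI)
  fix \<phi> \<psi> assume *: "\<phi> \<in> carr D" "\<psi> \<in> carr D" "\<U> \<phi> = \<U> \<psi>"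
  then have "\<phi> - \<psi> = 0"
    by (intro dual_map_eq_0_imp D.carr_diff) (simp_all add: dual_map_diff)
  then show "\<phi> = \<psi>"
    by simp
qed

lemma carr_dual_model: "carr B' = \<U> ` carr D"
  by (simp add: dual_model_def)

lemma nrm_dual_model: "\<phi> \<in> carr D \<Longrightarrow> nrm B' (\<U> \<phi>) = nrm D \<phi>"
  by (simp add: dual_model_def inv_into_f_f[OF inj_on_dual_map])

sublocale B': complex_normed_space B'
proof
  show "complex_vector.subspace (carr B')"
    unfolding carr_dual_model
  proof (rule complex_vector.subspaceI)
    show "0 \<in> \<U> ` carr D"
      using dual_map_zero D.carr_zero by force
    show "x + y \<in> \<U> ` carr D" if xy: "x \<in> \<U> ` carr D" "y \<in> \<U> ` carr D" for x y
    proof -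
      obtain \<phi> \<psi> where "\<phi> \<in> carr D" "x = \<U> \<phi>" "\<psi> \<in> carr D" "y = \<U> \<psi>"
        using xy by blast
      then show ?thesis
        by (intro image_eqI[of _ _ "\<phi> + \<psi>"]) (simp_all add: dual_map_add D.carr_add)
    qed
    show "a *\<^sub>C x \<in> \<U> ` carr D" if x: "x \<in> \<U> ` carr D" for a x
    proof -
      obtain \<phi> where "\<phi> \<in> carr D" "x = \<U> \<phi>"
        using x by blast
      then show ?thesis
        by (intro image_eqI[of _ _ "cnj a *\<^sub>C \<phi>"]) (simp_all add: dual_map_scale D.carr_scale)
    qed
  qed
  fix x assume "x \<in> carr B'"
  then obtain \<phi> where \<phi>: "\<phi> \<in> carr D" and x: "x = \<U> \<phi>"
    unfolding carr_dual_model by blast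
  show "nrm B' x = 0 \<longleftrightarrow> x = 0"
    unfolding x nrm_dual_model[OF \<phi>] D.nrm_eq_0[OF \<phi>]
    using dual_map_zero dual_map_eq_0_imp[OF \<phi>] by auto
  show "nrm B' (a *\<^sub>C x) = cmod a * nrm B' x" for a
    using nrm_dual_model[OF D.carr_scale[OF \<phi>, of "cnj a"]]
    by (simp add: x dual_map_scale[OF \<phi>] nrm_dual_model[OF \<phi>] D.nrm_scaleC[OF \<phi>])
  fix y assume "y \<in> carr B'"
  then obtain \<psi> where \<psi>: "\<psi> \<in> carr D" and y: "y = \<U> \<psi>"
    unfolding carr_dual_model by blast
  show "nrm B' (x + y) \<le> nrm B' x + nrm B' y"
    using nrm_dual_model[OF D.carr_add[OF \<phi> \<psi>]] D.nrm_triangle[OF \<phi> \<psi>]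
    by (simp add: x y dual_map_add[OF \<phi> \<psi>] nrm_dual_model \<phi> \<psi>)
qed

text \<open>
  The derivative of \<open>\<U> \<phi>\<close> at \<open>l\<close> is the vector that represents \<open>\<phi> \<circ> T\<close>, where \<open>T\<close> is the derivative
  of \<open>\<Psi>\<close> at \<open>cnj l\<close>. Two conjugations cancel: the one in the argument of \<open>\<Psi>\<close> and the one in the
  dependence of the representing vector on the functional. Hence \<open>\<U> \<phi>\<close> is holomorphic in \<open>l\<close> and not
  antiholomorphic.
\<close>

lemma dual_map_in_Hol:
  assumes \<phi>: "\<phi> \<in> carr D"
  shows "\<U> \<phi> \<in> Hol \<Omega>'"
proof -
  have "\<exists>v. ((\<lambda>w. norm (inverse (w - l) *\<^sub>C (\<U> \<phi> w - \<U> \<phi> l) - v)) \<longlongrightarrow> 0) (at l within \<Omega>')"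
    if l: "l \<in> \<Omega>'" for l
  proof -
    obtain T where T: "T \<in> carr Ops" and lim:
      "((\<lambda>w. nrm Ops (inverse (w - cnj l) *\<^sub>C (\<Psi> w - \<Psi> (cnj l)) - T)) \<longlongrightarrow> 0)
        (at (cnj l) within cnj ` \<Omega>')"
      using hol l unfolding holomorphic_into_def by blast
    obtain v where v: "\<And>e. \<phi> (T e) = cinner e v"
      using functional_operator_riesz[OF \<phi> T] by blast
    let ?S = "\<lambda>w. inverse (cnj w - cnj l) *\<^sub>C (\<Psi> (cnj w) - \<Psi> (cnj l)) - T"
    let ?u = "\<lambda>w. inverse (w - l) *\<^sub>C (\<U> \<phi> w - \<U> \<phi> l) - v"
    have le: "norm (?u w) \<le> nrm D \<phi> * nrm Ops (?S w)" if w: "w \<in> \<Omega>'" for w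
    proof (rule norm_riesz_vector_le[OF \<phi>])
      show "?S w \<in> carr Ops"
        by (intro Ops.carr_diff Ops.carr_scale Psi_carr T w l)
      fix e :: 'e
      have diff: "\<phi> (x - y) = \<phi> x - \<phi> y" if "x \<in> carr B" "y \<in> carr B" for x y
        using dual_spaceD(2)[OF \<phi> B.carr_diff[OF that] that(2)] by simp
      have cdiff: "cinner e (x - y) = cinner e x - cinner e y" for x y
        using cinner_add_right[of e "x - y" y] by simp
      have Te: "T e \<in> carr B"
        using bounded_opsD(2)[OF T] by simp
      show "\<phi> (?S w e) = cinner e (?u w)"
        using Psi_in[OF w, of e] Psi_in[OF l, of e] Te
        by (simp add: scaleC_fun_def[of _ "\<Psi> (cnj w) - \<Psi> (cnj l)"] diff dual_spaceD(3)[OF \<phi>]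
            B.carr_diff B.carr_scale v cdiff cinner_scaleC_right cinner_dual_map[OF \<phi>] w l)
    qed
    have "filterlim cnj (at (cnj l) within cnj ` \<Omega>') (at l within \<Omega>')"
      unfolding filterlim_at by (intro conjI tendsto_intros) (auto simp: eventually_at_filter)
    from filterlim_compose[OF lim this] have "((\<lambda>w. nrm Ops (?S w)) \<longlongrightarrow> 0) (at l within \<Omega>')" .
    then have "((\<lambda>w. nrm D \<phi> * nrm Ops (?S w)) \<longlongrightarrow> 0) (at l within \<Omega>')"
      by (rule tendsto_mult_right_zero)
    then have "((\<lambda>w. norm (?u w)) \<longlongrightarrow> 0) (at l within \<Omega>')"
      by (rule Lim_null_comparison[rotated]) (simp add: eventually_at_filter le)
    then show ?thesis
      by blast
  qed
  then show ?thesis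
    unfolding Hol_def holomorphic_into_def by (simp add: dual_map_outside)
qed

lemma dual_model_bound_on_compact:
  assumes K: "compact K" "K \<subseteq> \<Omega>'"
  shows "\<exists>C. \<forall>g\<in>carr B'. \<forall>l\<in>K. norm (g l) \<le> C * nrm B' g"
proof -
  have "compact ((\<lambda>w. nrm Ops (\<Psi> w)) ` cnj ` K)"
    using K by (intro compact_continuous_image
        continuous_on_subset[OF Ops.holomorphic_into_continuous_nrm[OF hol]] continuous_intros) auto
  then obtain C where C: "\<And>l. l \<in> K \<Longrightarrow> nrm Ops (\<Psi> (cnj l)) \<le> C"
    using compact_imp_bounded bounded_iff by (metis abs_le_D1 imageI real_norm_def)
  have "norm (\<U> \<phi> l) \<le> C * nrm B' (\<U> \<phi>)" if \<phi>: "\<phi> \<in> carr D" and l: "l \<in> K" for \<phi> l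
  proof -
    have l': "l \<in> \<Omega>'"
      using l K by blast
    have "norm (\<U> \<phi> l) \<le> nrm D \<phi> * nrm Ops (\<Psi> (cnj l))"
      by (rule norm_riesz_vector_le[OF \<phi> Psi_carr[OF l'] cinner_dual_map[OF \<phi> l']])
    also have "\<dots> \<le> nrm D \<phi> * C"
      by (intro mult_left_mono C[OF l] D.nrm_nonneg[OF \<phi>])
    finally show ?thesis
      by (simp add: nrm_dual_model[OF \<phi>] mult.commute)
  qed
  then show ?thesis
    unfolding carr_dual_model by blast
qed

theorem dual_model_A1: "cond_A1 B' \<Omega>'"
  unfolding cond_A1_def
proof
  show "continuous_map (norm_topology B') (Hol_topology \<Omega>') (\<lambda>f. f)"
    using dual_map_in_Hol
    by (intro continuous_map_Hol_topologyI B'.complex_normed_space_axioms dual_model_bound_on_compact)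
      (auto simp: carr_dual_model)
  show "inj_on (\<lambda>f. restrict f \<Omega>') (carr B')"
  proof (rule inj_onI)
    fix f g assume "f \<in> carr B'" "g \<in> carr B'" and eq: "restrict f \<Omega>' = restrict g \<Omega>'"
    then obtain \<phi> \<psi> where fg: "f = \<U> \<phi>" "g = \<U> \<psi>"
      unfolding carr_dual_model by blast
    show "f = g"
    proof
      fix l show "f l = g l"
        using fun_cong[OF eq, of l] by (cases "l \<in> \<Omega>'") (simp_all add: fg dual_map_outside)
    qed
  qed
qed

lemma dual_L_dual_map:
  assumes "\<phi> \<in> carr D"
  shows "dual_L B \<Omega>' \<Psi> (\<U> \<phi>) = \<U> (adjoint_op (mult_op B) \<phi>)"
  using assms by (simp add: dual_L_def carr_dual_model inv_into_f_f[OF inj_on_dual_map])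

lemma mult_op_dual_map:
  assumes L: "cond_A3 L \<Omega>' \<Psi>" and \<phi>: "\<phi> \<in> carr D"
  shows "mult_op B' (\<U> \<phi>) = \<U> (adjoint_op L \<phi>)"
proof (rule dual_map_eqI[symmetric])
  fix l e assume l: "l \<in> \<Omega>'"
  have "L (\<Psi> (cnj l) e) = cnj l *\<^sub>C \<Psi> (cnj l) e"
    using fun_cong[OF bspec[OF L[unfolded cond_A3_def] l], of e]
    by (simp add: scaleC_fun_def[of _ "\<Psi> (cnj l)"])
  then show "adjoint_op L \<phi> (\<Psi> (cnj l) e) = cinner e (mult_op B' (\<U> \<phi>) l)"
    using \<phi> by (simp add: adjoint_op_def dual_spaceD(3)[OF \<phi> Psi_in[OF l]] mult_op_def
        carr_dual_model cinner_scaleC_right cinner_dual_map[OF \<phi> l])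
qed (use \<phi> in \<open>simp add: mult_op_def carr_dual_model dual_map_outside\<close>)

end

section \<open>Evaluation functionals and reflexivity\<close>

locale reflexive_dual_model = dual_model_data +
  fixes \<Omega> :: "complex set"
  assumes reflexive: "reflexive_space B"
    and B_Hol: "carr B \<subseteq> Hol \<Omega>"
    and mult_acts: "\<And>f. f \<in> carr B \<Longrightarrow> mult_op B f \<in> carr B"
    and inclusion: "continuous_map (norm_topology B) (Hol_topology \<Omega>) (\<lambda>f. f)"
begin

abbreviation "\<Psi>' \<equiv> dual_Psi B \<Omega>' \<Psi>"

lemma eval_functional_in_dual:
  assumes z: "z \<in> \<Omega>"
  shows "eval_functional B z e \<in> carr D"
proof -
  obtain C where C: "\<And>f. f \<in> carr B \<Longrightarrow> norm (f z) \<le> C * nrm B f"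
    using point_evaluation_bounded[OF B.complex_normed_space_axioms inclusion z] by blast
  show ?thesis
    unfolding dual_space_def
  proof (rule bounded_opsI[where C = "C * norm e"])
    fix f assume f: "f \<in> carr B"
    have "cmod (cinner (f z) e) \<le> norm (f z) * norm e"
      by (rule cmod_cinner_le)
    also have "\<dots> \<le> C * nrm B f * norm e"
      by (intro mult_right_mono C[OF f]) simp
    finally show "nrm whole_space (eval_functional B z e f) \<le> C * norm e * nrm B f"
      using f by (simp add: eval_functional_def mult_ac)
    show "eval_functional B z e (a *\<^sub>C f) = a *\<^sub>C eval_functional B z e f" for a
      using f B.carr_scale[OF f, of a]
      by (simp add: eval_functional_def) (simp add: scaleC_fun_def cinner_scaleC_left scaleC_complex_def)
  qed (simp_all add: eval_functional_def B.carr_add cinner_add_left)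
qed

lemma dual_Psi_eq: "\<Psi>' (cnj z) e = \<U> (eval_functional B z e)"
  by (simp add: dual_Psi_def)

text \<open>
  If \<open>\<phi>\<close> had distance at least \<open>\<epsilon>\<close> from \<open>M\<close>, separation would give a functional on \<open>D\<close> that vanishes
  on \<open>M\<close> but not at \<open>\<phi>\<close>. Reflexivity turns it into evaluation at some \<open>f\<close> in \<open>B\<close> with
  \<open>f z = 0\<close> throughout \<open>\<Omega>\<close>.
\<close>

lemma eval_functionals_dense:
  defines "M \<equiv> complex_vector.span {eval_functional B z e | e z. z \<in> \<Omega>}"
  assumes \<phi>: "\<phi> \<in> carr D" and \<epsilon>: "0 < \<epsilon>"
  shows "M \<subseteq> carr D" and "\<exists>\<psi>\<in>M. nrm D (\<phi> - \<psi>) < \<epsilon>"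
proof -
  show M: "M \<subseteq> carr D"
    unfolding M_def using eval_functional_in_dual D.subspace_carr
    by (intro complex_vector.span_minimal) auto
  show "\<exists>\<psi>\<in>M. nrm D (\<phi> - \<psi>) < \<epsilon>"
  proof (rule ccontr)
    assume "\<not> (\<exists>\<psi>\<in>M. nrm D (\<phi> - \<psi>) < \<epsilon>)"
    then have far: "\<And>\<psi>. \<psi> \<in> M \<Longrightarrow> \<epsilon> \<le> nrm D (\<phi> - \<psi>)"
      by force
    have "complex_vector.subspace M"
      unfolding M_def by simp
    then obtain F where F: "F \<in> carr (dual_space D)" and FM: "\<And>\<psi>. \<psi> \<in> M \<Longrightarrow> F \<psi> = 0"
      and F\<phi>: "F \<phi> \<noteq> 0"
      using D.hahn_banach_separation[OF _ M \<phi> \<epsilon> far] by blast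
    obtain f where f: "f \<in> carr B" and Ff: "F = (\<lambda>\<psi>. if \<psi> \<in> carr D then \<psi> f else 0)"
      using F reflexive unfolding reflexive_space_def by blast
    have "f z = 0" for z
    proof (cases "z \<in> \<Omega>")
      case True
      have "cinner (f z) e = 0" for e
      proof -
        have "eval_functional B z e \<in> M"
          unfolding M_def using True by (intro complex_vector.span_base) blast
        from FM[OF this] show ?thesis
          using f eval_functional_in_dual[OF True, of e] by (simp add: Ff eval_functional_def)
      qed
      from this[of "f z"] show ?thesis
        by (simp add: cinner_self)
    next
      case False
      then show ?thesis
        using f B_Hol unfolding Hol_def by auto
    qed
    then have "f = 0"
      by (simp add: fun_eq_iff)
    then have "F \<phi> = 0"
      using dual_spaceD(3)[OF \<phi> f, of 0] \<phi> by (simp add: Ff)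
    with F\<phi> show False
      by simp
  qed
qed

theorem dual_model_A2: "cond_A2 B' \<Omega> \<Psi>'"
proof -
  let ?M = "complex_vector.span {eval_functional B z e | e z. z \<in> \<Omega>}"
  let ?G = "{\<Psi>' (cnj z) e | e z. z \<in> \<Omega>}"
  have MD: "?M \<subseteq> carr D"
    using eval_functionals_dense(1)[OF D.carr_zero zero_less_one] .
  have "?G \<subseteq> carr B'"
    using eval_functional_in_dual by (auto simp: dual_Psi_eq carr_dual_model)
  then have GB: "complex_vector.span ?G \<subseteq> carr B'"
    by (intro complex_vector.span_minimal B'.subspace_carr)
  have "?M \<subseteq> {\<psi> \<in> carr D. \<U> \<psi> \<in> complex_vector.span ?G}"
  proof (rule complex_vector.span_minimal)
    have "\<U> (eval_functional B z e) \<in> complex_vector.span ?G" if "z \<in> \<Omega>" for z e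
      unfolding dual_Psi_eq[symmetric] using that by (intro complex_vector.span_base) blast
    then show "{eval_functional B z e | e z. z \<in> \<Omega>} \<subseteq> {\<psi> \<in> carr D. \<U> \<psi> \<in> complex_vector.span ?G}"
      using eval_functional_in_dual by blast
    \<comment> \<open>The set of \<open>\<psi>\<close> with \<open>\<U> \<psi>\<close> in the span is a subspace, although \<open>\<U>\<close> is only conjugate-linear.\<close>
    show "complex_vector.subspace {\<psi> \<in> carr D. \<U> \<psi> \<in> complex_vector.span ?G}"
      by (intro complex_vector.subspaceI)
        (auto simp: D.carr_zero D.carr_add D.carr_scale dual_map_zero dual_map_add dual_map_scale
          complex_vector.span_zero complex_vector.span_add complex_vector.span_scale)
  qed
  then have UM: "\<U> \<psi> \<in> complex_vector.span ?G" if "\<psi> \<in> ?M" for \<psi>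
    using that by blast
  have "\<exists>s\<in>complex_vector.span ?G. nrm B' (g - s) < \<epsilon>" if g: "g \<in> carr B'" and \<epsilon>: "0 < \<epsilon>" for g \<epsilon>
  proof -
    obtain \<phi> where \<phi>: "\<phi> \<in> carr D" and g: "g = \<U> \<phi>"
      using g unfolding carr_dual_model by blast
    obtain \<psi> where \<psi>: "\<psi> \<in> ?M" "nrm D (\<phi> - \<psi>) < \<epsilon>"
      using eval_functionals_dense(2)[OF \<phi> \<epsilon>] by blast
    have \<psi>D: "\<psi> \<in> carr D"
      using \<psi>(1) MD by blast
    have "nrm B' (g - \<U> \<psi>) < \<epsilon>"
      using \<psi>(2) nrm_dual_model[OF D.carr_diff[OF \<phi> \<psi>D]] by (simp add: g dual_map_diff[OF \<phi> \<psi>D])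
    then show ?thesis
      using UM[OF \<psi>(1)] by blast
  qed
  then show ?thesis
    unfolding cond_A2_def B'.dense_in_iff[OF GB] by blast
qed

theorem dual_model_A3: "cond_A3 (dual_L B \<Omega>' \<Psi>) \<Omega> \<Psi>'"
  unfolding cond_A3_def
proof (rule ballI, rule ext)
  fix z e assume z: "z \<in> \<Omega>"
  let ?\<phi> = "eval_functional B z e"
  note \<phi> = eval_functional_in_dual[OF z, of e]
  have "\<U> (adjoint_op (mult_op B) ?\<phi>) = cnj z *\<^sub>C \<U> ?\<phi>"
  proof (rule dual_map_eqI)
    fix l d assume l: "l \<in> \<Omega>'"
    let ?f = "\<Psi> (cnj l) d"
    have f: "?f \<in> carr B"
      by (rule Psi_in[OF l])
    have "?\<phi> (mult_op B ?f) = z * ?\<phi> ?f"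
      using f mult_acts[OF f]
      by (simp add: eval_functional_def) (simp add: mult_op_def cinner_scaleC_left)
    then show "adjoint_op (mult_op B) ?\<phi> ?f = cinner d ((cnj z *\<^sub>C \<U> ?\<phi>) l)"
      by (simp add: adjoint_op_def cinner_dual_map[OF \<phi> l] scaleC_fun_def cinner_scaleC_right)
  qed (simp add: scaleC_fun_def dual_map_outside)
  then show "(dual_L B \<Omega>' \<Psi> \<circ> \<Psi>' (cnj z)) e = (cnj z *\<^sub>C \<Psi>' (cnj z)) e"
    by (simp add: dual_Psi_eq dual_L_dual_map[OF \<phi>] scaleC_fun_def[of _ "\<Psi>' (cnj z)"])
qed

theorem dual_Psi_symmetric:
  assumes z: "z \<in> \<Omega>" and l: "l \<in> \<Omega>'"
  shows "cinner (\<Psi>' (cnj z) e1 l) e2 = cinner e1 (\<Psi> (cnj l) e2 z)"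
proof -
  have "cinner e2 (\<Psi>' (cnj z) e1 l) = eval_functional B z e1 (\<Psi> (cnj l) e2)"
    unfolding dual_Psi_eq by (rule cinner_dual_map[OF eval_functional_in_dual[OF z] l, symmetric])
  also have "\<dots> = cinner (\<Psi> (cnj l) e2 z) e1"
    by (simp add: eval_functional_def Psi_in[OF l])
  finally show ?thesis
    using cinner_commute by metis
qed

end

section \<open>The dual tuple\<close>

theorem theorem4p3:
  fixes \<Omega> \<Omega>' :: "complex set"
    and B :: "(complex \<Rightarrow> 'e::complex_hilbert_space) nspace"
    and L :: "(complex \<Rightarrow> 'e) \<Rightarrow> (complex \<Rightarrow> 'e)"
    and \<Psi> :: "complex \<Rightarrow> 'e \<Rightarrow> (complex \<Rightarrow> 'e)"
  assumes "open \<Omega>" and "open \<Omega>'"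
    and "complex_banach_space B" and "reflexive_space B"
    and "carr B \<subseteq> Hol \<Omega>"
    and "\<forall>f\<in>carr B. mult_op B f \<in> carr B"
    and "L \<in> carr (bounded_ops B B)"
    and "\<forall>f\<in>carr B. L (mult_op B f) = f"
    and "holomorphic_into (cnj ` \<Omega>') (bounded_ops whole_space B) \<Psi>"
    and "cond_A1 B \<Omega>" and "cond_A2 B \<Omega>' \<Psi>" and "cond_A3 L \<Omega>' \<Psi>"
  defines "\<U> \<equiv> dual_map \<Omega>' \<Psi>"
    and "B' \<equiv> dual_model B \<Omega>' \<Psi>"
    and "L' \<equiv> dual_L B \<Omega>' \<Psi>"
    and "\<Psi>' \<equiv> dual_Psi B \<Omega>' \<Psi>"
  shows "cond_A1 B' \<Omega>' \<and> cond_A2 B' \<Omega> \<Psi>' \<and> cond_A3 L' \<Omega> \<Psi>' \<and>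
    (\<forall>\<phi>\<in>carr (dual_space B). L' (\<U> \<phi>) = \<U> (adjoint_op (mult_op B) \<phi>)) \<and>
    (\<forall>\<phi>\<in>carr (dual_space B). mult_op B' (\<U> \<phi>) = \<U> (adjoint_op L \<phi>)) \<and>
    (\<forall>e1 e2. \<forall>z\<in>\<Omega>. \<forall>l\<in>\<Omega>'.
      cinner (\<Psi>' (cnj z) e1 l) e2 = cinner e1 (\<Psi> (cnj l) e2 z))"
proof -
  interpret dual: reflexive_dual_model B \<Omega>' \<Psi> \<Omega>
    using assms(4-6,9-11) complex_banach_space.axioms(1)[OF assms(3)]
    by (auto simp: reflexive_dual_model_def reflexive_dual_model_axioms_def
        dual_model_data_def dual_model_data_axioms_def cond_A1_def)
  show ?thesis
    unfolding \<U>_def B'_def L'_def \<Psi>'_def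
    using dual.dual_model_A1 dual.dual_model_A2 dual.dual_model_A3 dual.dual_L_dual_map
      dual.mult_op_dual_map[OF assms(12)] dual.dual_Psi_symmetric
    by blast
qed

end
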